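(* Let $n\geq 1$, let $\rho_n:\mathfrak{sl}(2,\mathbb{C})\to\mathfrak{sl}(n+1,\mathbb{C})$ be the irreducible representation of $\mathfrak{sl}(2,\mathbb{C})$ on $\mathbb{C}^{n+1}$, let $G_1=\langle\exp\rho_n(\mathfrak{sl}(2,\mathbb{C}))\rangle$, and let $G_1\cdot[v_0]\subset\mathbb{P}^n$ be the projective orbit of the highest weight space $[v_0]$. Then $G_1\cdot[v_0]$ is diffeomorphic to $S^2$. Let $\pi:\mathbb{C}^{n+1}\setminus\{0\}\to\mathbb{P}^n$ be the tautological line bundle over $\mathbb{P}^n$ and denote by $\tau_n$ its restriction (pull back) to $S^2=G_1\cdot[v_0]$. Then $\tau_n$ is not a trivial line bundle. In fact $\tau_n$ is represented by the homotopy class $n\in\mathbb{Z}=\pi_1(\mathbb{C}_{\times})$.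
   Context: $\mathbb{P}^n$ is the complex projective space of lines in $\mathbb{C}^{n+1}$, $[v]$ is the line spanned by $v\neq0$, and $\mathbb{C}_\times=\mathbb{C}\setminus\{0\}$. Let $X=\begin{pmatrix}0&1\\0&0\end{pmatrix}$, $H=\begin{pmatrix}1&0\\0&-1\end{pmatrix}$, $Y=\begin{pmatrix}0&0\\1&0\end{pmatrix}$. The basis $\{v_0,\dots,v_n\}$ of $\mathbb{C}^{n+1}$ is chosen so that $\rho_n(H)=\mathrm{diag}\{n,n-2,\dots,-n\}$, $\rho_n(Y)v_j=v_{j+1}$ (with $v_{n+1}=0$) and $\rho_n(X)v_j=j(n-j+1)v_{j-1}$. The tautological line bundle is identified with its bundle of nonzero vectors $\mathbb{C}^{n+1}\setminus\{0\}\to\mathbb{P}^n$ (a principal $\mathbb{C}_\times$-bundle). Convention for the class in $\pi_1(\mathbb{C}_\times)$: a complex line bundle on $S^2$ is obtained by clutching trivial bundles on two hemispheres along the equator $S^1$ by a function $a:S^1\to\mathbb{C}_\times$, and is represented by the homotopy class of $a$. Here the hemispheres are $\{[e^{z\rho_n(Y)}v_0]:|z|\le1\}$ and $\{[e^{w\rho_n(X)}v_n]:|w|\le 1\}$, with common equator $|z|=|w|=1$ (where $w=1/z$), parametrized by $w\in S^1$; if $\chi_1,\chi_2$ are nowhere zero continuous sections over the first and second hemisphere respectively, then $a$ is defined by $\chi_2=a\,\chi_1$ on the equator, and its class is its winding number. *)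

theory Defs
  imports "HOL-Complex_Analysis.Complex_Analysis" "HOL-Algebra.Generated_Groups"
begin

section \<open>Representations of \<open>sl(2)\<close>\<close>

definition sl :: "(complex^'n^'n) set" where
  "sl = {A. trace A = 0}"

definition lie_bracket :: "complex^'n^'n \<Rightarrow> complex^'n^'n \<Rightarrow> complex^'n^'n" where
  "lie_bracket A B = A ** B - B ** A"

definition sl_X :: "complex^2^2" where
  "sl_X = vector [vector [0, 1], vector [0, 0]]"

definition sl_H :: "complex^2^2" where
  "sl_H = vector [vector [1, 0], vector [0, -1]]"

definition sl_Y :: "complex^2^2" where
  "sl_Y = vector [vector [0, 0], vector [1, 0]]"

text \<open>Multiplication of a matrix by a complex scalar; the library's \<open>*s\<close> would here
  take a row vector as its scalar.\<close>

abbreviation mat_scale :: "complex \<Rightarrow> complex^'n^'m \<Rightarrow> complex^'n^'m" where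
  "mat_scale c \<equiv> map_matrix ((*) c)"

text \<open>Only the values of \<open>\<rho>\<close> on \<^term>\<open>sl :: (complex^2^2) set\<close> are constrained.\<close>

definition sl2_representation :: "(complex^2^2 \<Rightarrow> complex^'n^'n) \<Rightarrow> bool" where
  "sl2_representation \<rho> \<longleftrightarrow>
     (\<forall>A\<in>sl. \<rho> A \<in> sl) \<and>
     (\<forall>A\<in>sl. \<forall>B\<in>sl. \<rho> (A + B) = \<rho> A + \<rho> B) \<and>
     (\<forall>c. \<forall>A\<in>sl. \<rho> (mat_scale c A) = mat_scale c (\<rho> A)) \<and>
     (\<forall>A\<in>sl. \<forall>B\<in>sl. \<rho> (lie_bracket A B) = lie_bracket (\<rho> A) (\<rho> B))"

definition irreducible_sl2_representation :: "(complex^2^2 \<Rightarrow> complex^'n^'n) \<Rightarrow> bool" where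
  "irreducible_sl2_representation \<rho> \<longleftrightarrow>
     sl2_representation \<rho> \<and>
     (\<forall>W. vec.subspace W \<and> (\<forall>A\<in>sl. \<forall>x\<in>W. \<rho> A *v x \<in> W) \<longrightarrow> W = {0} \<or> W = UNIV)"

text \<open>Only \<open>v 0, \<dots>, v n\<close> matter. In the \<open>X\<close> relation, truncated subtraction is harmless:
  for \<open>j = 0\<close> the coefficient vanishes.\<close>

definition weight_basis ::
  "(complex^2^2 \<Rightarrow> complex^'n^'n) \<Rightarrow> nat \<Rightarrow> (nat \<Rightarrow> complex^'n) \<Rightarrow> bool" where
  "weight_basis \<rho> n v \<longleftrightarrow>
     inj_on v {..n} \<and> vec.independent (v ` {..n}) \<and> vec.span (v ` {..n}) = UNIV \<and>
     (\<forall>j\<le>n. \<rho> sl_H *v v j = (of_nat n - 2 * of_nat j) *s v j) \<and>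
     (\<forall>j\<le>n. \<rho> sl_Y *v v j = (if j < n then v (j + 1) else 0)) \<and>
     (\<forall>j\<le>n. \<rho> sl_X *v v j = of_nat (j * (n - j + 1)) *s v (j - 1))"

section \<open>The group generated by exponentials\<close>

definition mat_exp :: "complex^'n^'n \<Rightarrow> complex^'n^'n" where
  "mat_exp A = (\<Sum>k. (1 / fact k) *\<^sub>R (((**) A ^^ k) (mat 1)))"

definition GL :: "(complex^'n^'n) monoid" where
  "GL = \<lparr>carrier = {A. invertible A}, mult = (**), one = mat 1\<rparr>"

lemma group_GL: "group (GL :: (complex^'n^'n) monoid)"
proof (rule groupI)
  show "\<one>\<^bsub>GL\<^esub> \<in> carrier (GL :: (complex^'n^'n) monoid)"
    unfolding GL_def invertible_def by (auto intro!: exI[of _ "mat 1"])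
next
  fix A B :: "complex^'n^'n"
  assume "A \<in> carrier (GL :: (complex^'n^'n) monoid)" "B \<in> carrier GL"
  then show "A \<otimes>\<^bsub>GL\<^esub> B \<in> carrier GL"
    by (simp add: GL_def invertible_mult)
next
  fix A B C :: "complex^'n^'n"
  assume "A \<in> carrier (GL :: (complex^'n^'n) monoid)" "B \<in> carrier GL" "C \<in> carrier GL"
  show "(A \<otimes>\<^bsub>GL\<^esub> B) \<otimes>\<^bsub>GL\<^esub> C = A \<otimes>\<^bsub>GL\<^esub> (B \<otimes>\<^bsub>GL\<^esub> C)"
    by (simp add: GL_def matrix_mul_assoc)
next
  fix A :: "complex^'n^'n"
  assume "A \<in> carrier (GL :: (complex^'n^'n) monoid)"
  show "\<one>\<^bsub>GL\<^esub> \<otimes>\<^bsub>GL\<^esub> A = A"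
    by (simp add: GL_def)
next
  fix A :: "complex^'n^'n"
  assume "A \<in> carrier (GL :: (complex^'n^'n) monoid)"
  then obtain B where B: "A ** B = mat 1" "B ** A = mat 1"
    by (auto simp: GL_def invertible_def)
  then have "B \<in> carrier GL"
    unfolding GL_def invertible_def by auto
  with B(2) show "\<exists>B\<in>carrier GL. B \<otimes>\<^bsub>GL\<^esub> A = \<one>\<^bsub>GL\<^esub>"
    by (intro bexI[of _ B]) (simp_all add: GL_def)
qed

definition exp_group :: "(complex^2^2 \<Rightarrow> complex^'n^'n) \<Rightarrow> (complex^'n^'n) set" where
  "exp_group \<rho> = generate GL (mat_exp ` \<rho> ` sl)"

section \<open>Complex projective space\<close>

definition proj_point :: "complex^'n \<Rightarrow> (complex^'n) set" where
  "proj_point x = vec.span {x}"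

definition proj_space :: "(complex^'n) set set" where
  "proj_space = proj_point ` (- {0})"

text \<open>The quotient topology.\<close>

definition proj_topology :: "(complex^'n) set topology" where
  "proj_topology = topology (\<lambda>U. U \<subseteq> proj_space \<and> open {x. x \<noteq> 0 \<and> proj_point x \<in> U})"

lemma openin_proj_topology:
  "openin proj_topology U \<longleftrightarrow> U \<subseteq> proj_space \<and> open {x. x \<noteq> 0 \<and> proj_point x \<in> U}"
proof -
  have "istopology (\<lambda>U. U \<subseteq> (proj_space :: (complex^'n) set set) \<and>
          open {x. x \<noteq> 0 \<and> proj_point x \<in> U})"
    unfolding istopology_def
  proof (intro conjI allI impI)
    fix S T :: "(complex^'n) set set"
    assume S: "S \<subseteq> proj_space \<and> open {x. x \<noteq> 0 \<and> proj_point x \<in> S}"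
      and T: "T \<subseteq> proj_space \<and> open {x. x \<noteq> 0 \<and> proj_point x \<in> T}"
    have "{x. x \<noteq> 0 \<and> proj_point x \<in> S \<inter> T} =
          {x. x \<noteq> 0 \<and> proj_point x \<in> S} \<inter> {x. x \<noteq> 0 \<and> proj_point x \<in> T}"
      by auto
    with S T show "open {x. x \<noteq> 0 \<and> proj_point x \<in> S \<inter> T}"
      by (simp add: open_Int)
    show "S \<inter> T \<subseteq> proj_space" using S by auto
  next
    fix K :: "(complex^'n) set set set"
    assume K: "\<forall>S\<in>K. S \<subseteq> proj_space \<and> open {x. x \<noteq> 0 \<and> proj_point x \<in> S}"
    have "{x. x \<noteq> 0 \<and> proj_point x \<in> \<Union>K} =
          (\<Union>S\<in>K. {x. x \<noteq> 0 \<and> proj_point x \<in> S})"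
      by auto
    with K show "open {x. x \<noteq> 0 \<and> proj_point x \<in> \<Union>K}"
      by (simp add: open_UN)
    show "\<Union>K \<subseteq> proj_space" using K by auto
  qed
  from topology_inverse'[OF this] show ?thesis
    unfolding proj_topology_def by (rule fun_cong)
qed

lemma topspace_proj_topology: "topspace proj_topology = proj_space"
proof
  show "topspace proj_topology \<subseteq> proj_space"
    using openin_topspace[of proj_topology] unfolding openin_proj_topology by (rule conjunct1)
  have eq: "{x. x \<noteq> 0 \<and> proj_point x \<in> proj_space} = - {0 :: complex^'n}"
    unfolding proj_space_def by blast
  have "open (- {0 :: complex^'n})"
    by (rule open_Compl) (rule closed_singleton)
  then have "openin proj_topology (proj_space :: (complex^'n) set set)"
    unfolding openin_proj_topology eq by (rule conjI[OF subset_refl])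
  then show "(proj_space :: (complex^'n) set set) \<subseteq> topspace proj_topology"
    by (rule openin_subset)
qed

lemma quotient_map_proj_point:
  "quotient_map (top_of_set (- {0 :: complex^'n})) proj_topology proj_point"
proof -
  have "openin (top_of_set (- {0})) {x \<in> - {0}. proj_point x \<in> U} \<longleftrightarrow>
        openin proj_topology U" if "U \<subseteq> proj_space" for U :: "(complex^'n) set set"
  proof -
    have eq: "{x \<in> - {0}. proj_point x \<in> U} = {x. x \<noteq> 0 \<and> proj_point x \<in> U}"
      by blast
    have "{x. x \<noteq> 0 \<and> proj_point x \<in> U} \<subseteq> - {0}"
      by blast
    moreover have "open (- {0 :: complex^'n})"
      by (rule open_Compl) (rule closed_singleton)
    ultimately show ?thesis
      unfolding openin_proj_topology eq using that openin_open_eq by blast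
  qed
  moreover have "proj_point ` (- {0}) = (proj_space :: (complex^'n) set set)"
    by (simp only: proj_space_def)
  ultimately show ?thesis
    unfolding quotient_map_def topspace_proj_topology topspace_euclidean_subtopology by blast
qed

definition proj_orbit :: "(complex^'n^'n) set \<Rightarrow> (complex^'n) set \<Rightarrow> (complex^'n) set set" where
  "proj_orbit G L = {(*v) A ` L | A. A \<in> G}"

definition highest_weight_orbit ::
  "(complex^2^2 \<Rightarrow> complex^'n^'n) \<Rightarrow> (nat \<Rightarrow> complex^'n) \<Rightarrow> (complex^'n) set set" where
  "highest_weight_orbit \<rho> v = proj_orbit (exp_group \<rho>) (proj_point (v 0))"

section \<open>Smooth maps and diffeomorphisms\<close>

text \<open>\<open>C\<^sup>k\<close> functions on an open set \<open>U\<close>, by iterated directional derivatives.\<close>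

primrec Ck_on :: "nat \<Rightarrow> 'a::euclidean_space set \<Rightarrow> ('a \<Rightarrow> 'b::euclidean_space) \<Rightarrow> bool" where
  "Ck_on 0 U f \<longleftrightarrow> continuous_on U f"
| "Ck_on (Suc k) U f \<longleftrightarrow>
     f differentiable_on U \<and> (\<forall>h. Ck_on k U (\<lambda>x. frechet_derivative f (at x) h))"

text \<open>On an arbitrary set, a map is smooth if locally it extends to a smooth map on an open set.\<close>

definition smooth_map_on :: "'a::euclidean_space set \<Rightarrow> ('a \<Rightarrow> 'b::euclidean_space) \<Rightarrow> bool" where
  "smooth_map_on A f \<longleftrightarrow>
     (\<forall>x\<in>A. \<exists>U F. open U \<and> x \<in> U \<and> (\<forall>k. Ck_on k U F) \<and> (\<forall>y\<in>A \<inter> U. F y = f y))"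

text \<open>The standard affine charts of projective space. The chart values (all homogeneous
  coordinates divided by the \<open>i\<close>-th one) are kept in the affine hyperplane \<open>w $ i = 1\<close> instead of
  dropping the constant coordinate \<open>1\<close>; a function on an open subset of this hyperplane is
  smooth iff it locally extends smoothly to the ambient space.\<close>

definition chart_domain :: "'n \<Rightarrow> (complex^'n) set set" where
  "chart_domain i = {L \<in> proj_space. \<exists>w\<in>L. w $ i \<noteq> 0}"

definition affine_chart :: "'n \<Rightarrow> (complex^'n) set \<Rightarrow> complex^'n" where
  "affine_chart i L = (THE w. w \<in> L \<and> w $ i = 1)"

definition smooth_to_proj :: "'a::euclidean_space set \<Rightarrow> ('a \<Rightarrow> (complex^'n) set) \<Rightarrow> bool" where
  "smooth_to_proj A f \<longleftrightarrow>
     (\<forall>x\<in>A. \<exists>i U. open U \<and> x \<in> U \<and> f ` (A \<inter> U) \<subseteq> chart_domain i \<and>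
        smooth_map_on (A \<inter> U) (affine_chart i \<circ> f))"

text \<open>On the image of the chart \<open>i\<close>, the inverse of the chart is \<^const>\<open>proj_point\<close>.\<close>

definition smooth_from_proj ::
  "(complex^'n) set set \<Rightarrow> ((complex^'n) set \<Rightarrow> 'a::euclidean_space) \<Rightarrow> bool" where
  "smooth_from_proj S g \<longleftrightarrow>
     (\<forall>i. smooth_map_on (affine_chart i ` (S \<inter> chart_domain i)) (\<lambda>w. g (proj_point w)))"

text \<open>Diffeomorphism between a subset of a Euclidean space and a subset of projective space;
  if \<open>A\<close> is a submanifold, then this says that \<open>S\<close> is an embedded submanifold diffeomorphic
  to \<open>A\<close>.\<close>

definition diffeomorphic_proj :: "'a::euclidean_space set \<Rightarrow> (complex^'n) set set \<Rightarrow> bool" where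
  "diffeomorphic_proj A S \<longleftrightarrow> S \<subseteq> proj_space \<and>
     (\<exists>f g. smooth_to_proj A f \<and> smooth_from_proj S g \<and>
        (\<forall>x\<in>A. f x \<in> S \<and> g (f x) = x) \<and> (\<forall>L\<in>S. g L \<in> A \<and> f (g L) = L))"

section \<open>Line bundles\<close>

text \<open>A line bundle over \<open>B\<close> is given by its bundle of nonzero vectors: the total space \<open>E\<close>,
  the projection \<open>p\<close> and the action \<open>s\<close> of the nonzero scalars. It is trivial if it is
  isomorphic to the product bundle.\<close>

definition trivial_line_bundle ::
  "'e topology \<Rightarrow> 'b topology \<Rightarrow> ('e \<Rightarrow> 'b) \<Rightarrow> (complex \<Rightarrow> 'e \<Rightarrow> 'e) \<Rightarrow> bool" where
  "trivial_line_bundle E B p s \<longleftrightarrow>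
     (\<exists>\<phi>. homeomorphic_map (prod_topology B (top_of_set (- {0}))) E \<phi> \<and>
        (\<forall>b\<in>topspace B. \<forall>c\<in>- {0}. p (\<phi> (b, c)) = b \<and>
           (\<forall>d\<in>- {0}. \<phi> (b, d * c) = s d (\<phi> (b, c)))))"

text \<open>The sections with values in the bundle of nonzero vectors are the nowhere zero sections.\<close>

definition section_over ::
  "'e topology \<Rightarrow> 'b topology \<Rightarrow> ('e \<Rightarrow> 'b) \<Rightarrow> 'b set \<Rightarrow> ('b \<Rightarrow> 'e) \<Rightarrow> bool" where
  "section_over E B p D \<sigma> \<longleftrightarrow>
     continuous_map (subtopology B D) E \<sigma> \<and> (\<forall>b\<in>D. p (\<sigma> b) = b)"

text \<open>\<open>h1\<close> and \<open>h2\<close> embed the closed unit disc as two hemispheres covering \<open>B\<close> and meeting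
  exactly in the common equator, where their coordinates are related by inversion.\<close>

definition hemispheres :: "'b topology \<Rightarrow> (complex \<Rightarrow> 'b) \<Rightarrow> (complex \<Rightarrow> 'b) \<Rightarrow> bool" where
  "hemispheres B h1 h2 \<longleftrightarrow>
     embedding_map (top_of_set (cball 0 1)) B h1 \<and>
     embedding_map (top_of_set (cball 0 1)) B h2 \<and>
     h1 ` cball 0 1 \<union> h2 ` cball 0 1 = topspace B \<and>
     h1 ` cball 0 1 \<inter> h2 ` cball 0 1 = h2 ` sphere 0 1 \<and>
     (\<forall>w\<in>sphere 0 1. h1 (1 / w) = h2 w)"

definition clutching_function ::
  "'e topology \<Rightarrow> 'b topology \<Rightarrow> ('e \<Rightarrow> 'b) \<Rightarrow> (complex \<Rightarrow> 'e \<Rightarrow> 'e) \<Rightarrow>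
   (complex \<Rightarrow> 'b) \<Rightarrow> (complex \<Rightarrow> 'b) \<Rightarrow> (complex \<Rightarrow> complex) \<Rightarrow> bool" where
  "clutching_function E B p s h1 h2 a \<longleftrightarrow>
     continuous_on (sphere 0 1) a \<and> a ` sphere 0 1 \<subseteq> - {0} \<and>
     (\<exists>\<sigma>1 \<sigma>2. section_over E B p (h1 ` cball 0 1) \<sigma>1 \<and> section_over E B p (h2 ` cball 0 1) \<sigma>2 \<and>
        (\<forall>w\<in>sphere 0 1. \<sigma>2 (h2 w) = s (a w) (\<sigma>1 (h2 w))))"

text \<open>The class in \<open>\<pi>\<^sub>1\<close> of the punctured plane is identified with an integer by the winding
  number; it is required to be the same for all choices of the two sections.\<close>

definition represented_by_class ::
  "'e topology \<Rightarrow> 'b topology \<Rightarrow> ('e \<Rightarrow> 'b) \<Rightarrow> (complex \<Rightarrow> 'e \<Rightarrow> 'e) \<Rightarrow>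
   (complex \<Rightarrow> 'b) \<Rightarrow> (complex \<Rightarrow> 'b) \<Rightarrow> int \<Rightarrow> bool" where
  "represented_by_class E B p s h1 h2 k \<longleftrightarrow>
     hemispheres B h1 h2 \<and>
     (\<exists>a. clutching_function E B p s h1 h2 a) \<and>
     (\<forall>a. clutching_function E B p s h1 h2 a \<longrightarrow>
        winding_number (a \<circ> circlepath 0 1) 0 = of_int k)"

text \<open>The total space of the tautological bundle (of nonzero vectors) restricted to \<open>S\<close>; the
  projection is \<^const>\<open>proj_point\<close> and the action is scalar multiplication.\<close>

definition taut_total :: "(complex^'n) set set \<Rightarrow> (complex^'n) topology" where
  "taut_total S = top_of_set {x. x \<noteq> 0 \<and> proj_point x \<in> S}"

end

theory Submission
  imports Defs
begin

text \<open>Put \<open>F(a, b) = \<Sum>\<^sub>j a\<^bsup>n-j\<^esup> b\<^bsup>j\<^esup>/j! v\<^sub>j\<close>, a form of the rational normal curve. It is homogeneous of degree \<open>n\<close>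
  and intertwines \<open>\<complex>\<^sup>2\<close> with \<open>\<rho>\<close>, so that \<open>e\<^bsup>\<rho>(A)\<^esup> F(u) = F(e\<^bsup>A\<^esup> u)\<close> and the orbit of \<open>[v\<^sub>0] = [F(1, 0)]\<close> is the
  image of \<open>F\<close>, a copy of the Riemann sphere. Ratios of basis coordinates recover \<open>[a : b]\<close> from \<open>[F(a, b)]\<close>,
  which makes the inverse smooth. Moreover \<open>e\<^bsup>zY\<^esup> v\<^sub>0 = F(1, z)\<close> and \<open>e\<^bsup>wX\<^esup> v\<^sub>n = n! F(w, 1)\<close>, and
  \<open>F(w, 1) = w\<^bsup>n\<^esup> F(1, 1/w)\<close>, hence the clutching function \<open>w\<^bsup>n\<^esup>\<close>. Any other pair of sections changes it by
  nowhere zero functions on discs, which have logarithms, so the winding number is always \<open>n\<close>; a trivial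
  bundle would have the clutching function \<open>1\<close>.\<close>

no_notation fps_nth (infixl \<open>$\<close> 75)

section \<open>Closure properties of smooth maps\<close>

lemma Ck_on_Suc_has_derivative:
  assumes "open U" "Ck_on (Suc k) U f" "x \<in> U"
  shows "(f has_derivative frechet_derivative f (at x)) (at x)"
  using assms by (metis Ck_on.simps(2) differentiable_on_eq_differentiable_at frechet_derivative_works)

text \<open>On an open set, agreement of functions forces agreement of their derivatives, so the
  induction on \<open>k\<close> can pass to directional derivatives.\<close>

lemma Ck_on_cong:
  assumes "open U" "\<And>x. x \<in> U \<Longrightarrow> f x = g x" "Ck_on k U f"
  shows "Ck_on k U g"
  using assms(2,3)
proof (induction k arbitrary: f g)
  case 0
  then show ?case by (simp cong: continuous_on_cong)
next
  case (Suc k)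
  have deriv: "(g has_derivative frechet_derivative f (at x)) (at x)" if "x \<in> U" for x
    by (rule has_derivative_transform_within_open[OF Ck_on_Suc_has_derivative[OF assms(1) Suc.prems(2) that] assms(1) that])
      (rule Suc.prems(1))
  then have "g differentiable_on U"
    by (meson differentiable_def differentiable_at_imp_differentiable_on)
  moreover have "Ck_on k U (\<lambda>x. frechet_derivative g (at x) h)" for h
  proof (rule Suc.IH)
    show "Ck_on k U (\<lambda>x. frechet_derivative f (at x) h)" using Suc.prems(2) by simp
    show "frechet_derivative f (at x) h = frechet_derivative g (at x) h" if "x \<in> U" for x
      using frechet_derivative_at[OF deriv[OF that]] by simp
  qed
  ultimately show ?case by simp
qed

text \<open>By uniqueness of the derivative, an explicit formula \<open>f'\<close> may stand in for
  \<open>frechet_derivative\<close>; the differentiation rules enter the closure lemmas in this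
  way.\<close>

lemma Ck_on_SucI:
  assumes "open U" "\<And>x. x \<in> U \<Longrightarrow> (f has_derivative f' x) (at x)" "\<And>h. Ck_on k U (\<lambda>x. f' x h)"
  shows "Ck_on (Suc k) U f"
proof -
  have "f differentiable_on U"
    using assms(2) by (meson differentiable_def differentiable_at_imp_differentiable_on)
  moreover have "Ck_on k U (\<lambda>x. frechet_derivative f (at x) h)" for h
    by (rule Ck_on_cong[OF assms(1) _ assms(3)[of h]]) (metis assms(2) frechet_derivative_at)
  ultimately show ?thesis by simp
qed

text \<open>Product and quotient rules leave undifferentiated factors, which must be weakened from
  order \<open>Suc k\<close> to order \<open>k\<close>.\<close>

lemma Ck_on_lower: "open U \<Longrightarrow> Ck_on (Suc k) U f \<Longrightarrow> Ck_on k U f"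
proof (induction k arbitrary: f)
  case 0
  then show ?case by (simp add: differentiable_imp_continuous_on)
next
  case (Suc k)
  then show ?case by (metis Ck_on.simps(2))
qed

lemma Ck_on_const: "open U \<Longrightarrow> Ck_on k U (\<lambda>x. c)"
  by (induction k arbitrary: c) (auto intro!: Ck_on_SucI[where f'="\<lambda>_ _. 0"])

lemma Ck_on_bounded_linear:
  assumes "open U" "bounded_linear L"
  shows "Ck_on k U L"
proof (cases k)
  case 0
  then show ?thesis using assms by (simp add: linear_continuous_on)
next
  case (Suc m)
  show ?thesis unfolding Suc
    using assms by (intro Ck_on_SucI[where f'="\<lambda>_. L"])
      (auto intro: Ck_on_const bounded_linear_imp_has_derivative)
qed

lemma Ck_on_compose_bounded_linear:
  assumes "open U" "bounded_linear L" "Ck_on k U f"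
  shows "Ck_on k U (\<lambda>x. L (f x))"
  using assms(3)
proof (induction k arbitrary: f)
  case 0
  then show ?case
    using continuous_on_compose2[OF linear_continuous_on[OF assms(2), of UNIV]] by simp
next
  case (Suc k)
  show ?case
    by (rule Ck_on_SucI[OF assms(1) bounded_linear.has_derivative[OF assms(2)
          Ck_on_Suc_has_derivative[OF assms(1) Suc.prems]]])
      (use Suc assms(1) in auto)
qed

lemma Ck_on_add:
  assumes "open U" "Ck_on k U f" "Ck_on k U g"
  shows "Ck_on k U (\<lambda>x. f x + g x)"
  using assms(2,3)
proof (induction k arbitrary: f g)
  case 0
  then show ?case by (simp add: continuous_on_add)
next
  case (Suc k)
  show ?case
    by (rule Ck_on_SucI[OF assms(1) has_derivative_add[OF
          Ck_on_Suc_has_derivative[OF assms(1) Suc.prems(1)]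
          Ck_on_Suc_has_derivative[OF assms(1) Suc.prems(2)]]])
      (use Suc assms(1) in auto)
qed

lemma Ck_on_mult:
  fixes f g :: "'a::euclidean_space \<Rightarrow> complex"
  assumes "open U" "Ck_on k U f" "Ck_on k U g"
  shows "Ck_on k U (\<lambda>x. f x * g x)"
  using assms(2,3)
proof (induction k arbitrary: f g)
  case 0
  then show ?case by (simp add: continuous_on_mult)
next
  case (Suc k)
  show ?case
    by (rule Ck_on_SucI[OF assms(1) has_derivative_mult[OF
          Ck_on_Suc_has_derivative[OF assms(1) Suc.prems(1)]
          Ck_on_Suc_has_derivative[OF assms(1) Suc.prems(2)]]])
      (use Suc.prems Ck_on_lower[OF assms(1)] in \<open>auto intro!: Ck_on_add Suc.IH simp: assms(1)\<close>)
qed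

text \<open>The derivative of 1/f contains 1/f again, but only to order \<open>k\<close>, where the
  induction hypothesis supplies it.\<close>

lemma Ck_on_inverse:
  fixes f :: "'a::euclidean_space \<Rightarrow> complex"
  assumes "open U" "\<And>x. x \<in> U \<Longrightarrow> f x \<noteq> 0" "Ck_on k U f"
  shows "Ck_on k U (\<lambda>x. inverse (f x))"
  using assms(3)
proof (induction k)
  case 0
  then show ?case using assms(2) by (simp add: continuous_on_inverse)
next
  case (Suc k)
  have 1: "Ck_on k U (\<lambda>x. inverse (f x))"
    using Suc Ck_on_lower[OF assms(1)] by blast
  have "Ck_on k U (\<lambda>x. - (inverse (f x) * frechet_derivative f (at x) h * inverse (f x)))" for h
    using Suc.prems 1 assms(1)
    by (intro Ck_on_compose_bounded_linear[OF assms(1) bounded_linear_minus[OF bounded_linear_ident]] Ck_on_mult) auto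
  then show ?case
    by (intro Ck_on_SucI[OF assms(1) Deriv.has_derivative_inverse[OF assms(2)
          Ck_on_Suc_has_derivative[OF assms(1) Suc.prems]]]) (use assms(1) in auto)
qed

lemma Ck_on_power:
  fixes f :: "'a::euclidean_space \<Rightarrow> complex"
  shows "open U \<Longrightarrow> Ck_on k U f \<Longrightarrow> Ck_on k U (\<lambda>x. f x ^ m)"
  by (induction m) (simp_all add: Ck_on_const Ck_on_mult)

lemma Ck_on_sum:
  assumes "open U" "\<And>i. i \<in> I \<Longrightarrow> Ck_on k U (f i)"
  shows "Ck_on k U (\<lambda>x. \<Sum>i\<in>I. f i x)"
  using assms(2)
  by (induction I rule: infinite_finite_induct) (simp_all add: Ck_on_const Ck_on_add assms(1))

lemma bounded_linear_vscale: "bounded_linear (\<lambda>c. c *s (y :: complex^'n))"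
  unfolding linear_conv_bounded_linear[symmetric]
  by (rule linearI) (simp_all add: vec_eq_iff algebra_simps)

text \<open>Expansion in the standard basis writes \<open>f\<close> as a sum of bounded linear
  images of its complex components.\<close>

lemma Ck_on_vec:
  fixes f :: "'a::euclidean_space \<Rightarrow> complex^'n"
  assumes "open U" "\<And>i. Ck_on k U (\<lambda>x. f x $ i)"
  shows "Ck_on k U f"
proof (rule Ck_on_cong[OF assms(1)])
  show "Ck_on k U (\<lambda>x. \<Sum>i\<in>UNIV. (f x $ i) *s axis i 1)"
    by (intro Ck_on_sum Ck_on_compose_bounded_linear[OF _ bounded_linear_vscale] assms)
qed (simp add: basis_expansion)

lemma Ck_on_subset:
  assumes "Ck_on k U f" "V \<subseteq> U"
  shows "Ck_on k V f"
  using assms(1)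
proof (induction k arbitrary: f)
  case 0
  then show ?case using continuous_on_subset[OF _ assms(2)] by simp
next
  case (Suc k)
  then show ?case using differentiable_on_subset[OF _ assms(2), of f] by simp
qed

section \<open>Smooth maps on arbitrary subsets\<close>

lemma smooth_map_on_continuous:
  assumes "smooth_map_on A f"
  shows "continuous_on A f"
  unfolding continuous_on_eq_continuous_within
proof
  fix x assume "x \<in> A"
  then obtain U F where U: "open U" "x \<in> U" "\<And>k. Ck_on k U F" "\<forall>y\<in>A \<inter> U. F y = f y"
    using assms unfolding smooth_map_on_def by blast
  have "continuous_on (A \<inter> U) F"
    using U(3)[of 0] continuous_on_subset[of U F "A \<inter> U"] by auto
  then have "continuous_on (A \<inter> U) f"
    using U(4) continuous_on_cong[of "A \<inter> U" "A \<inter> U" F f] by simp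
  then have "continuous (at x within A \<inter> U) f"
    using U(2) \<open>x \<in> A\<close> by (simp add: continuous_on_eq_continuous_within)
  then show "continuous (at x within A) f"
    using at_within_nhd[OF U(2,1), of A "A \<inter> U"] by auto
qed

lemma smooth_map_on_subset:
  assumes "smooth_map_on A f" "B \<subseteq> A"
  shows "smooth_map_on B f"
  unfolding smooth_map_on_def
proof
  fix x assume "x \<in> B"
  then have "x \<in> A" using assms(2) by (rule subsetD[rotated])
  then obtain U F where "open U" "x \<in> U" "\<forall>k. Ck_on k U F" "\<forall>y\<in>A \<inter> U. F y = f y"
    using assms(1) unfolding smooth_map_on_def by blast
  then show "\<exists>U F. open U \<and> x \<in> U \<and> (\<forall>k. Ck_on k U F) \<and> (\<forall>y\<in>B \<inter> U. F y = f y)"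
    using assms(2) by (intro exI[of _ U] exI[of _ F]) auto
qed

section \<open>Matrix exponentials\<close>

lemma bounded_linear_matrix_mult: "bounded_linear (\<lambda>B :: complex^'k^'n. A ** B)"
  unfolding linear_conv_bounded_linear[symmetric]
  by (rule linearI)
    (simp_all add: vec_eq_iff matrix_matrix_mult_def algebra_simps sum.distrib scaleR_sum_right)

lemma bounded_linear_matrix_vector_mult: "bounded_linear (\<lambda>B :: complex^'m^'n. B *v x)"
  unfolding linear_conv_bounded_linear[symmetric]
  by (rule linearI)
    (simp_all add: vec_eq_iff matrix_vector_mult_def algebra_simps sum.distrib scaleR_sum_right)

lemma matrix_vector_mult_nth: "(M *v x) $ i = (\<Sum>j\<in>UNIV. M $ i $ j * x $ j)"
  by (simp add: matrix_vector_mult_def)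

lemma matrix_power_vector_mult:
  fixes A :: "complex^'n^'n"
  shows "(((**) A ^^ k) (mat 1)) *v x = ((*v) A ^^ k) x"
  by (induction k) (simp_all add: matrix_vector_mul_assoc[symmetric])

text \<open>Left multiplication by \<open>A\<close> is bounded by some \<open>K\<close>, so the
  powers of \<open>A\<close> grow at most like \<open>K ^ k\<close> and an exponential series
  dominates.\<close>

lemma summable_mat_exp:
  fixes A :: "complex^'n^'n"
  shows "summable (\<lambda>k. (1 / fact k) *\<^sub>R (((**) A ^^ k) (mat 1)))"
proof -
  obtain K where K: "\<And>B :: complex^'n^'n. norm (A ** B) \<le> norm B * K" "K > 0"
    using bounded_linear.pos_bounded[OF bounded_linear_matrix_mult[of A]] by blast
  have bound: "norm (((**) A ^^ k) (mat 1)) \<le> K ^ k * norm (mat 1 :: complex^'n^'n)" for k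
  proof (induction k)
    case (Suc k)
    have "norm (((**) A ^^ Suc k) (mat 1)) \<le> norm (((**) A ^^ k) (mat 1)) * K"
      using K(1) by simp
    also have "\<dots> \<le> (K ^ k * norm (mat 1 :: complex^'n^'n)) * K"
      using Suc K(2) by (intro mult_right_mono) auto
    finally show ?case by (simp add: algebra_simps)
  qed simp
  show ?thesis
  proof (rule summable_comparison_test')
    show "summable (\<lambda>k. (inverse (fact k) * K ^ k) * norm (mat 1 :: complex^'n^'n))"
      by (intro summable_mult2 summable_exp)
    show "norm ((1 / fact k) *\<^sub>R (((**) A ^^ k) (mat 1))) \<le>
        (inverse (fact k) * K ^ k) * norm (mat 1 :: complex^'n^'n)" for k
      using bound[of k] by (simp add: field_simps)
  qed
qed

text \<open>Evaluation at \<open>x\<close> and taking a component are bounded linear and so pass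
  through the matrix series; this reduces \<open>mat_exp\<close> to scalar power series.\<close>

lemma mat_exp_vector_mult_sums:
  fixes A :: "complex^'n^'n"
  shows "(\<lambda>k. (((*v) A ^^ k) x) $ i / fact k) sums ((mat_exp A *v x) $ i)"
proof -
  have "(\<lambda>k. (((1 / fact k) *\<^sub>R (((**) A ^^ k) (mat 1))) *v x) $ i) sums ((mat_exp A *v x) $ i)"
    unfolding mat_exp_def
    by (intro bounded_linear.sums[OF bounded_linear_vec_nth]
        bounded_linear.sums[OF bounded_linear_matrix_vector_mult] summable_sums summable_mat_exp)
  moreover have "(((1 / fact k) *\<^sub>R (((**) A ^^ k) (mat 1))) *v x) $ i = (((*v) A ^^ k) x) $ i / fact k" for k
    using linear_scale[OF bounded_linear.linear[OF bounded_linear_matrix_vector_mult[of x]],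
        of "1 / fact k" "((**) A ^^ k) (mat 1)"]
    by (simp add: matrix_power_vector_mult scaleR_conv_of_real[where 'a=complex])
  ultimately show ?thesis by simp
qed

text \<open>By Taylor's theorem, an entire solution of \<open>\<psi>' = M \<psi>\<close> is \<open>\<psi>(t) = e\<^bsup>tM\<^esup> \<psi>(0)\<close>;
  only the value at \<open>1\<close> is needed.\<close>

lemma mat_exp_flow:
  fixes M :: "complex^'n^'n" and \<psi> :: "complex \<Rightarrow> complex^'n"
  assumes deriv: "\<And>t i. ((\<lambda>t. \<psi> t $ i) has_field_derivative (M *v \<psi> t) $ i) (at t)"
  shows "mat_exp M *v \<psi> 0 = \<psi> 1"
proof -
  have iter: "((\<lambda>t. ((*v) M ^^ k) (\<psi> t) $ i) has_field_derivative ((*v) M ^^ Suc k) (\<psi> t) $ i) (at t)"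
    for k t i
  proof (induction k arbitrary: i)
    case 0
    then show ?case using deriv by simp
  next
    case (Suc k)
    have "((\<lambda>t. \<Sum>j\<in>UNIV. M $ i $ j * ((*v) M ^^ k) (\<psi> t) $ j) has_field_derivative
        (\<Sum>j\<in>UNIV. M $ i $ j * ((*v) M ^^ Suc k) (\<psi> t) $ j)) (at t)"
      by (intro DERIV_sum DERIV_cmult Suc)
    then show ?case
      by (simp add: matrix_vector_mult_nth)
  qed
  \<comment> \<open>Hence the Taylor coefficients at 0 are those of the exponential series of
    \<open>M\<close> applied to \<open>\<psi> 0\<close>.\<close>
  have deriv_iter: "(deriv ^^ k) (\<lambda>t. \<psi> t $ i) = (\<lambda>t. ((*v) M ^^ k) (\<psi> t) $ i)" for k i
  proof (induction k)
    case (Suc k)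
    have "(deriv ^^ Suc k) (\<lambda>t. \<psi> t $ i) = deriv (\<lambda>t. ((*v) M ^^ k) (\<psi> t) $ i)"
      by (simp add: Suc)
    also have "\<dots> = (\<lambda>t. ((*v) M ^^ Suc k) (\<psi> t) $ i)"
      by (rule ext) (rule DERIV_imp_deriv[OF iter])
    finally show ?case .
  qed simp
  have "(mat_exp M *v \<psi> 0) $ i = \<psi> 1 $ i" for i
  proof -
    \<comment> \<open>Any radius above 1 would do: the point 1 has to lie inside the disc.\<close>
    have "(\<lambda>t. \<psi> t $ i) holomorphic_on ball 0 2"
      using deriv by (meson field_differentiable_def field_differentiable_at_within holomorphic_onI)
    then have "(\<lambda>k. (deriv ^^ k) (\<lambda>t. \<psi> t $ i) 0 / fact k * (1 - 0) ^ k) sums (\<psi> 1 $ i)"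
      by (rule holomorphic_power_series) simp
    then show ?thesis
      unfolding deriv_iter using mat_exp_vector_mult_sums[of M "\<psi> 0" i] by (simp add: sums_unique2)
  qed
  then show ?thesis by (simp add: vec_eq_iff)
qed

lemma mat_exp_0: "mat_exp 0 *v x = x" for x :: "complex^'n"
  using mat_exp_flow[of "\<lambda>_. x" 0] by simp

lemma mat_scale_vector_mult: "mat_scale c A *v x = c *s (A *v x)"
  by (simp add: vec_eq_iff matrix_vector_mult_def map_matrix_def sum_distrib_left mult.assoc)

text \<open>Each component is an everywhere convergent power series in \<open>t\<close>.
  Differentiating term by term shifts the coefficients, and the shifted ones are \<open>M\<close>
  applied to the old ones.\<close>

lemma mat_exp_has_derivative:
  fixes M :: "complex^'n^'n"
  shows "((\<lambda>t. (mat_exp (mat_scale t M) *v x) $ i) has_field_derivative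
     (M *v (mat_exp (mat_scale t M) *v x)) $ i) (at t)"
proof -
  have pow: "((*v) (mat_scale t M) ^^ k) x = t ^ k *s ((*v) M ^^ k) x" for t k
    by (induction k) (simp_all add: mat_scale_vector_mult vec.scale matrix_vector_mult_scaleR
        vector_scalar_commute vector_smult_assoc)
  define c where "c i k = ((*v) M ^^ k) x $ i / fact k" for i k
  have sums: "(\<lambda>k. c i k * t ^ k) sums ((mat_exp (mat_scale t M) *v x) $ i)" for i t
    using mat_exp_vector_mult_sums[of "mat_scale t M" x i]
    by (simp add: pow c_def mult.commute)
  have "((\<lambda>t. \<Sum>k. c i k * t ^ k) has_field_derivative (\<Sum>k. diffs (c i) k * t ^ k)) (at t)"
    using sums by (intro termdiffs_strong_converges_everywhere) (rule sums_summable)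
  moreover have "(\<lambda>k. diffs (c i) k * t ^ k) sums (M *v (mat_exp (mat_scale t M) *v x)) $ i"
  proof -
    have "(\<lambda>k. \<Sum>j\<in>UNIV. M $ i $ j * (c j k * t ^ k)) sums
        (\<Sum>j\<in>UNIV. M $ i $ j * (mat_exp (mat_scale t M) *v x) $ j)"
      by (intro sums_sum sums_mult sums)
    moreover have "(\<Sum>j\<in>UNIV. M $ i $ j * (c j k * t ^ k)) = diffs (c i) k * t ^ k" for k
    proof -
      have "diffs (c i) k = (M *v ((*v) M ^^ k) x) $ i / fact k"
        by (simp add: diffs_def c_def divide_simps del: of_nat_Suc)
      also have "\<dots> = (\<Sum>j\<in>UNIV. M $ i $ j * c j k)"
        by (simp add: matrix_vector_mult_def c_def sum_divide_distrib)
      finally show ?thesis by (simp add: sum_distrib_right mult.assoc)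
    qed
    ultimately show ?thesis by (simp add: matrix_vector_mult_def)
  qed
  ultimately show ?thesis
    using sums by (simp add: sums_iff)
qed

lemma mat_exp_minus: "mat_exp (- M) ** mat_exp M = mat 1"
proof -
  have one: "mat_scale 1 M = M" and zero: "mat_scale 0 M = 0"
    by (simp_all add: vec_eq_iff map_matrix_def)
  have "mat_exp (- M) *v (mat_exp M *v x) = x" for x
  proof -
    \<comment> \<open>Running the flow backwards, \<open>\<psi>\<close> solves the equation for
      \<open>- M\<close> and leads from \<open>mat_exp M *v x\<close> to \<open>x\<close>; this
      avoids multiplying two exponential series.\<close>
    define \<psi> where "\<psi> t = mat_exp (mat_scale (1 - t) M) *v x" for t
    have "((\<lambda>t. \<psi> t $ i) has_field_derivative (- M *v \<psi> t) $ i) (at t)" for t i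
    proof -
      have "((\<lambda>t. \<psi> t $ i) has_field_derivative ((M *v \<psi> t) $ i) * (0 - 1)) (at t)"
        unfolding \<psi>_def
        by (rule DERIV_chain2[OF mat_exp_has_derivative]) (intro derivative_intros)
      then show ?thesis
        by (simp add: matrix_vector_mult_def sum_negf)
    qed
    then have "mat_exp (- M) *v \<psi> 0 = \<psi> 1"
      by (rule mat_exp_flow)
    then show ?thesis by (simp add: \<psi>_def one zero mat_exp_0)
  qed
  then show ?thesis
    by (simp add: matrix_eq matrix_vector_mul_assoc[symmetric])
qed

lemma mat_exp_in_GL: "mat_exp M \<in> carrier GL"
  using mat_exp_minus[of M] mat_exp_minus[of "- M"] unfolding GL_def invertible_def by auto

lemma inv_mat_exp: "inv\<^bsub>GL\<^esub> (mat_exp M) = mat_exp (- M)"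
  by (rule group.inv_equality[OF group_GL])
    (simp_all add: mat_exp_in_GL, simp add: GL_def mat_exp_minus)

text \<open>Inverses of the generators are again exponentials, with \<open>A\<close> replaced by its
  negative, so invariance under the exponentials themselves suffices.\<close>

lemma exp_group_invariant:
  assumes \<rho>: "sl2_representation \<rho>"
    and inv: "\<And>A x. A \<in> sl \<Longrightarrow> x \<in> C \<Longrightarrow> mat_exp (\<rho> A) *v x \<in> C"
    and g: "g \<in> exp_group \<rho>" and x: "x \<in> C"
  shows "g *v x \<in> C"
  using g x unfolding exp_group_def
proof (induction g arbitrary: x rule: generate.induct)
  case one
  then show ?case by (simp add: GL_def)
next
  case (incl h)
  then show ?case using inv by auto
next
  case (inv h)
  then obtain A where A: "A \<in> sl" "h = mat_exp (\<rho> A)" by auto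
  have "mat_scale (-1) A \<in> sl"
    using A(1) by (simp add: sl_def trace_def map_matrix_def sum_negf)
  moreover have "\<rho> (mat_scale (-1) A) = - \<rho> A"
  proof -
    have "\<rho> (mat_scale (-1) A) = mat_scale (-1) (\<rho> A)"
      using \<rho> A(1) unfolding sl2_representation_def by blast
    then show ?thesis by (simp add: vec_eq_iff map_matrix_def)
  qed
  ultimately show ?case
    using assms(2)[of "mat_scale (-1) A" x] inv.prems A(2) by (simp add: inv_mat_exp)
next
  case (eng h1 h2)
  then show ?case by (simp add: GL_def matrix_vector_mul_assoc[symmetric])
qed

section \<open>The rational normal curve\<close>

text \<open>The general traceless matrix, with rows \<open>(h, x)\<close> and
  \<open>(y, - h)\<close>; its flow on pairs is a' = h a + x b, b' = y a - h b.\<close>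

definition sl_elem :: "complex \<Rightarrow> complex \<Rightarrow> complex \<Rightarrow> complex^2^2" where
  "sl_elem h x y = mat_scale h sl_H + (mat_scale x sl_X + mat_scale y sl_Y)"

lemma sl_basis: "sl_H \<in> sl" "sl_X \<in> sl" "sl_Y \<in> sl"
  by (simp_all add: sl_def trace_def sl_H_def sl_X_def sl_Y_def UNIV_2)

lemma sl_scale: "A \<in> sl \<Longrightarrow> mat_scale c A \<in> sl" for A :: "complex^2^2"
  by (simp add: sl_def trace_def map_matrix_def sum_distrib_left[symmetric])

lemma sl_add: "A \<in> sl \<Longrightarrow> B \<in> sl \<Longrightarrow> A + B \<in> sl" for A B :: "complex^2^2"
  by (simp add: sl_def trace_add)

lemma sl_eq_sl_elem:
  assumes "A \<in> sl"
  obtains h x y where "A = sl_elem h x y"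
proof
  have "A $ 1 $ 1 + A $ 2 $ 2 = 0"
    using assms by (simp add: sl_def trace_def UNIV_2 add.commute)
  then have "A $ 2 $ 2 = - A $ 1 $ 1"
    by (metis add_eq_0_iff)
  then show "A = sl_elem (A $ 1 $ 1) (A $ 1 $ 2) (A $ 2 $ 1)"
    by (simp add: vec_eq_iff forall_2 sl_elem_def map_matrix_def sl_H_def sl_X_def sl_Y_def)
qed

lemma sl_elem_in_sl: "sl_elem h x y \<in> sl"
  by (simp add: sl_elem_def sl_basis sl_scale sl_add)

locale sl2_weight_basis =
  fixes n :: nat
    and \<rho> :: "complex^2^2 \<Rightarrow> complex^'n^'n"
    and v :: "nat \<Rightarrow> complex^'n"
  assumes n_pos: "n \<ge> 1"
    and representation: "sl2_representation \<rho>"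
    and basis: "weight_basis \<rho> n v"
begin

lemma inj_v: "inj_on v {..n}"
  and independent_v: "vec.independent (v ` {..n})"
  and span_v: "vec.span (v ` {..n}) = UNIV"
  and rho_H: "j \<le> n \<Longrightarrow> \<rho> sl_H *v v j = (of_nat n - 2 * of_nat j) *s v j"
  and rho_Y: "j \<le> n \<Longrightarrow> \<rho> sl_Y *v v j = (if j < n then v (j + 1) else 0)"
  and rho_X: "j \<le> n \<Longrightarrow> \<rho> sl_X *v v j = of_nat (j * (n - j + 1)) *s v (j - 1)"
  using basis unfolding weight_basis_def by blast+

text \<open>For nonzero \<open>a\<close> this is \<open>a ^ n\<close> times e^(zY) v_0 with z = b/a,
  which explains the factorials; the homogeneous form also includes the point with
  \<open>a = 0\<close>.\<close>

definition curve :: "complex \<Rightarrow> complex \<Rightarrow> complex^'n" where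
  "curve a b = (\<Sum>j\<le>n. (a ^ (n - j) * b ^ j / fact j) *s v j)"

definition coord :: "nat \<Rightarrow> complex^'n \<Rightarrow> complex" where
  "coord j x = vec.representation (v ` {..n}) x (v j)"

lemma coord_add: "coord j (x + y) = coord j x + coord j y"
  unfolding coord_def using independent_v span_v by (simp add: vec.representation_add)

lemma coord_scale: "coord j (c *s x) = c * coord j x"
  unfolding coord_def using independent_v span_v by (simp add: vec.representation_scale)

lemma coord_zero: "coord j 0 = 0"
  using coord_scale[of j 0 0] by simp

lemma coord_sum: "coord j (\<Sum>i\<in>I. f i) = (\<Sum>i\<in>I. coord j (f i))"
  by (induction I rule: infinite_finite_induct) (simp_all add: coord_zero coord_add)

lemma coord_v: "j \<le> n \<Longrightarrow> k \<le> n \<Longrightarrow> coord j (v k) = (if j = k then 1 else 0)"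
  unfolding coord_def using vec.representation_basis[OF independent_v, of "v k"] inj_onD[OF inj_v, of j k]
  by auto

lemma coord_curve: "j \<le> n \<Longrightarrow> coord j (curve a b) = a ^ (n - j) * b ^ j / fact j"
  by (simp add: curve_def coord_sum coord_scale coord_v if_distrib cong: if_cong)

lemma bounded_linear_coord: "bounded_linear (coord j)"
proof -
  have "r *\<^sub>R x = of_real r *s x" for r and x :: "complex^'n"
    by (simp add: vec_eq_iff) (simp add: scaleR_conv_of_real)
  then have "coord j (r *\<^sub>R x) = r *\<^sub>R coord j x" for r x
    by (simp add: coord_scale scaleR_conv_of_real)
  then show ?thesis
    unfolding linear_conv_bounded_linear[symmetric] by (intro linearI) (simp_all add: coord_add)
qed

text \<open>Every term has total degree \<open>n\<close>. Taken at \<open>c = w\<close>,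
  \<open>a = 1\<close>, \<open>b = 1 / w\<close>, this is the origin of the clutching
  function.\<close>

lemma curve_scale: "curve (c * a) (c * b) = c ^ n *s curve a b"
proof -
  have "(c * a) ^ (n - j) * (c * b) ^ j = c ^ n * (a ^ (n - j) * b ^ j)" if "j \<le> n" for j
  proof -
    have "c ^ n = c ^ (n - j) * c ^ j"
      using that by (simp add: power_add[symmetric])
    then show ?thesis by (simp add: power_mult_distrib)
  qed
  then show ?thesis
    by (simp add: curve_def vec.scale_sum_right sum_distrib_left vector_smult_assoc)
qed

text \<open>The outermost coordinates \<open>a ^ n\<close> and \<open>b ^ n / fact n\<close> detect
  whether the pair vanishes.\<close>

lemma curve_eq_zero_iff: "curve a b = 0 \<longleftrightarrow> a = 0 \<and> b = 0"
proof
  assume "curve a b = 0"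
  then show "a = 0 \<and> b = 0"
    using coord_curve[of 0 a b] coord_curve[of n a b] n_pos by (simp add: coord_zero)
next
  assume "a = 0 \<and> b = 0"
  then show "curve a b = 0"
    using curve_scale[of 0 0 0] n_pos by (simp add: power_0_left)
qed

text \<open>Here and in the next two lemmas, X, Y and H act on the curve as the vector fields b
  d/da, a d/db and a d/da - b d/db. Exponents cut off at 0 by truncated subtraction occur only with
  coefficient 0.\<close>

lemma rho_X_curve:
  "\<rho> sl_X *v curve a b = (\<Sum>j\<le>n. (of_nat (n - j) * a ^ (n - j - 1) * b ^ (j + 1) / fact j) *s v j)"
proof -
  obtain m where m: "n = Suc m" using n_pos by (cases n) auto
  have "\<rho> sl_X *v curve a b = (\<Sum>j\<le>n. (a ^ (n - j) * b ^ j / fact j) *s (\<rho> sl_X *v v j))"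
    by (simp add: curve_def vec.sum vec.scale)
  also have "\<dots> = (\<Sum>j\<le>n. (a ^ (n - j) * b ^ j / fact j * of_nat (j * (n - j + 1))) *s v (j - 1))"
    by (intro sum.cong refl) (simp only: atMost_iff rho_X vector_smult_assoc)
  \<comment> \<open>The summand \<open>j = 0\<close> carries the factor 0, so the index can be
    shifted down.\<close>
  also have "\<dots> = (\<Sum>j\<le>m. (a ^ (m - j) * b ^ Suc j / fact (Suc j) * of_nat (Suc j * (m - j + 1))) *s v j)"
    unfolding m by (subst sum.atMost_Suc_shift) simp
  also have "\<dots> = (\<Sum>j\<le>m. (of_nat (n - j) * a ^ (n - j - 1) * b ^ (j + 1) / fact j) *s v j)"
    by (intro sum.cong refl) (simp add: m Suc_diff_le field_simps del: of_nat_Suc mult_Suc mult_Suc_right)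
  \<comment> \<open>The missing summand \<open>j = n\<close> has the coefficient
    \<open>n - j = 0\<close>.\<close>
  finally show ?thesis by (simp add: m)
qed

lemma rho_Y_curve:
  "\<rho> sl_Y *v curve a b = (\<Sum>j\<le>n. (of_nat j * a ^ (n - j + 1) * b ^ (j - 1) / fact j) *s v j)"
proof -
  obtain m where m: "n = Suc m" using n_pos by (cases n) auto
  have "\<rho> sl_Y *v curve a b = (\<Sum>j\<le>n. (a ^ (n - j) * b ^ j / fact j) *s (\<rho> sl_Y *v v j))"
    by (simp add: curve_def vec.sum vec.scale)
  also have "\<dots> = (\<Sum>j\<le>m. (a ^ (n - j) * b ^ j / fact j) *s v (Suc j))"
    by (simp add: m rho_Y)
  also have "\<dots> = (\<Sum>j\<le>m. (of_nat (Suc j) * a ^ (n - Suc j + 1) * b ^ (Suc j - 1) / fact (Suc j)) *s v (Suc j))"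
    by (intro sum.cong refl) (simp add: m Suc_diff_le field_simps del: of_nat_Suc)
  also have "\<dots> = (\<Sum>j\<le>n. (of_nat j * a ^ (n - j + 1) * b ^ (j - 1) / fact j) *s v j)"
    unfolding m sum.atMost_Suc_shift by simp
  finally show ?thesis .
qed

lemma rho_H_curve:
  "\<rho> sl_H *v curve a b = (\<Sum>j\<le>n. ((of_nat n - 2 * of_nat j) * (a ^ (n - j) * b ^ j / fact j)) *s v j)"
proof -
  have "\<rho> sl_H *v curve a b = (\<Sum>j\<le>n. (a ^ (n - j) * b ^ j / fact j) *s (\<rho> sl_H *v v j))"
    by (simp add: curve_def vec.sum vec.scale)
  also have "\<dots> = (\<Sum>j\<le>n. ((of_nat n - 2 * of_nat j) * (a ^ (n - j) * b ^ j / fact j)) *s v j)"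
    by (intro sum.cong refl) (simp only: atMost_iff rho_H vector_smult_assoc mult.commute)
  finally show ?thesis .
qed

lemma rho_scale: "A \<in> sl \<Longrightarrow> \<rho> (mat_scale c A) = mat_scale c (\<rho> A)"
  using representation unfolding sl2_representation_def by blast

lemma rho_sl_elem:
  "\<rho> (sl_elem h x y) *v w = h *s (\<rho> sl_H *v w) + x *s (\<rho> sl_X *v w) + y *s (\<rho> sl_Y *v w)"
proof -
  have "\<rho> (A + B) = \<rho> A + \<rho> B" if "A \<in> sl" "B \<in> sl" for A B
    using representation that unfolding sl2_representation_def by blast
  then have "\<rho> (sl_elem h x y) = mat_scale h (\<rho> sl_H) + (mat_scale x (\<rho> sl_X) + mat_scale y (\<rho> sl_Y))"
    by (simp add: sl_elem_def sl_basis sl_scale sl_add rho_scale)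
  then show ?thesis
    by (simp add: matrix_vector_mult_add_rdistrib mat_scale_vector_mult)
qed

text \<open>With \<open>F = curve\<close> as a map on \<open>\<complex>\<^sup>2\<close>, this is \<open>\<rho>(A) F(u) = DF(u)(A u)\<close>: the curve intertwines the
  standard representation with \<open>\<rho>\<close>.\<close>

lemma curve_has_derivative:
  assumes a: "(a has_field_derivative h * a t + x * b t) (at t)"
    and b: "(b has_field_derivative y * a t - h * b t) (at t)"
  shows "((\<lambda>t. curve (a t) (b t) $ i) has_field_derivative
    (\<rho> (sl_elem h x y) *v curve (a t) (b t)) $ i) (at t)"
proof -
  have pow_a: "((\<lambda>t. a t ^ k) has_field_derivative of_nat k * (h * a t + x * b t) * a t ^ (k - 1)) (at t)" for k
    using DERIV_power[OF a, of k] by (simp add: mult.assoc)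
  have pow_b: "((\<lambda>t. b t ^ k) has_field_derivative of_nat k * (y * a t - h * b t) * b t ^ (k - 1)) (at t)" for k
    using DERIV_power[OF b, of k] by (simp add: mult.assoc)
  define D where "D j = (of_nat (n - j) * (h * a t + x * b t) * a t ^ (n - j - 1)) * b t ^ j
      + (of_nat j * (y * a t - h * b t) * b t ^ (j - 1)) * a t ^ (n - j)" for j
  have "((\<lambda>t. \<Sum>j\<le>n. (a t ^ (n - j) * b t ^ j / fact j) * v j $ i) has_field_derivative
      (\<Sum>j\<le>n. D j / fact j * v j $ i)) (at t)"
    unfolding D_def
    by (intro DERIV_sum DERIV_cmult_right DERIV_cdivide DERIV_mult pow_a pow_b)
  moreover have "D j / fact j = h * ((of_nat n - 2 * of_nat j) * (a t ^ (n - j) * b t ^ j / fact j))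
      + x * (of_nat (n - j) * a t ^ (n - j - 1) * b t ^ (j + 1) / fact j)
      + y * (of_nat j * a t ^ (n - j + 1) * b t ^ (j - 1) / fact j)" if "j \<le> n" for j
  proof -
    \<comment> \<open>For \<open>n - j = 0\<close> the exponent \<open>n - j - 1\<close> is cut off
      at 0, and only the vanishing coefficient keeps the identity true; likewise for
      \<open>j = 0\<close> in the next one.\<close>
    have 1: "of_nat (n - j) * a t ^ (n - j - 1) * a t = of_nat (n - j) * a t ^ (n - j)"
      by (cases "n - j") simp_all
    have 2: "of_nat j * b t ^ (j - 1) * b t = of_nat j * b t ^ j"
      by (cases j) simp_all
    have 3: "of_nat n - 2 * of_nat j = (of_nat (n - j) - of_nat j :: complex)"
      using that by (simp add: of_nat_diff)
    have "D j = h * (of_nat (n - j) * a t ^ (n - j - 1) * a t) * b t ^ j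
        - h * (of_nat j * b t ^ (j - 1) * b t) * a t ^ (n - j)
        + x * (of_nat (n - j) * a t ^ (n - j - 1) * b t ^ (j + 1))
        + y * (of_nat j * a t ^ (n - j + 1) * b t ^ (j - 1))"
      unfolding D_def by (simp add: algebra_simps)
    also have "\<dots> = h * ((of_nat n - 2 * of_nat j) * (a t ^ (n - j) * b t ^ j))
        + x * (of_nat (n - j) * a t ^ (n - j - 1) * b t ^ (j + 1))
        + y * (of_nat j * a t ^ (n - j + 1) * b t ^ (j - 1))"
      unfolding 1 2 3 by (simp add: algebra_simps)
    finally show ?thesis by (simp add: add_divide_distrib)
  qed
  then have "(\<Sum>j\<le>n. D j / fact j * v j $ i) = (\<rho> (sl_elem h x y) *v curve (a t) (b t)) $ i"
    by (simp add: rho_sl_elem rho_H_curve rho_X_curve rho_Y_curve sum_distrib_left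
        sum.distrib[symmetric] distrib_right mult.assoc)
  ultimately show ?thesis by (simp add: curve_def)
qed

text \<open>Any explicit solution of the linear system of \<open>sl_elem h x y\<close> on pairs is
  carried by F to a flow line of its image under \<open>\<rho>\<close>.\<close>

lemma mat_exp_curve:
  assumes "\<And>t. (a has_field_derivative h * a t + x * b t) (at t)"
    and "\<And>t. (b has_field_derivative y * a t - h * b t) (at t)"
  shows "mat_exp (\<rho> (sl_elem h x y)) *v curve (a 0) (b 0) = curve (a 1) (b 1)"
  using mat_exp_flow[of "\<lambda>t. curve (a t) (b t)"] curve_has_derivative assms by blast

end

section \<open>Projective space and the Hopf map\<close>

lemma proj_point_eq_range: "proj_point x = range (\<lambda>c. c *s x)"
  by (simp add: proj_point_def vec.span_singleton)

lemma mem_proj_point: "x \<in> proj_point x"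
  by (simp add: proj_point_def vec.span_base)

lemma proj_point_scale: "c \<noteq> 0 \<Longrightarrow> proj_point (c *s x) = proj_point x"
proof -
  assume c: "c \<noteq> 0"
  have "d *s x \<in> range (\<lambda>e. e *s (c *s x))" for d
    using c by (intro range_eqI[of _ _ "d / c"]) (simp add: vector_smult_assoc)
  then show ?thesis
    by (auto simp: proj_point_eq_range vector_smult_assoc)
qed

lemma proj_point_eqD:
  assumes "proj_point x = proj_point y" "y \<noteq> 0"
  obtains c where "c \<noteq> 0" "y = c *s x"
proof -
  have "y \<in> range (\<lambda>c. c *s x)"
    using assms(1) mem_proj_point[of y] by (simp add: proj_point_eq_range)
  then obtain c where "y = c *s x" by blast
  with assms(2) that show thesis by (cases "c = 0") auto
qed

lemma matrix_image_proj_point: "(*v) A ` proj_point x = proj_point (A *v x)"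
  by (auto simp: proj_point_eq_range image_image vec.scale)

lemma affine_chart_proj_point:
  fixes x :: "complex^'n"
  assumes "x $ i \<noteq> 0"
  shows "affine_chart i (proj_point x) = inverse (x $ i) *s x"
  unfolding affine_chart_def
proof (rule the_equality)
  show "inverse (x $ i) *s x \<in> proj_point x \<and> (inverse (x $ i) *s x) $ i = 1"
    using assms by (auto simp: proj_point_eq_range)
next
  fix w assume w: "w \<in> proj_point x \<and> w $ i = 1"
  then obtain c where c: "w = c *s x"
    by (auto simp: proj_point_eq_range)
  moreover have "c * x $ i = 1" using w c by simp
  then have "c = inverse (x $ i)"
    using assms by (simp add: field_simps)
  ultimately show "w = inverse (x $ i) *s x" by simp
qed

lemma proj_point_chart_domain: "x $ i \<noteq> 0 \<Longrightarrow> proj_point x \<in> chart_domain i" for x :: "complex^'n"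
  unfolding chart_domain_def proj_space_def using mem_proj_point by fastforce

text \<open>A local lift to homogeneous coordinates suffices: where its component \<open>i\<close>
  is nonzero, division by this component gives the chart value.\<close>

lemma smooth_to_projI:
  assumes "\<And>x. x \<in> A \<Longrightarrow> \<exists>U F. open U \<and> x \<in> U \<and> (\<forall>k. Ck_on k U F) \<and> F x \<noteq> 0 \<and>
    (\<forall>y\<in>A \<inter> U. f y = proj_point (F y))"
  shows "smooth_to_proj A (f :: 'a::euclidean_space \<Rightarrow> (complex^'n) set)"
  unfolding smooth_to_proj_def
proof
  fix x assume "x \<in> A"
  then obtain U F where U: "open U" "x \<in> U" and F: "\<And>k. Ck_on k U F" "F x \<noteq> 0"
    and f: "\<And>y. y \<in> A \<inter> U \<Longrightarrow> f y = proj_point (F y)"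
    using assms by meson
  obtain i where i: "F x $ i \<noteq> 0"
    using F(2) by (auto simp: vec_eq_iff)
  have Fi: "Ck_on k U (\<lambda>y. F y $ i)" for k i
    by (rule Ck_on_compose_bounded_linear[OF U(1) bounded_linear_vec_nth F(1)])
  define V where "V = U \<inter> (\<lambda>y. F y $ i) -` (- {0})"
  have V: "open V" "x \<in> V" "V \<subseteq> U"
    unfolding V_def using U i Fi[of 0] by (auto intro!: continuous_open_preimage)
  have FV: "Ck_on k V (\<lambda>y. F y $ i)" for k i
    by (rule Ck_on_subset[OF Fi V(3)])
  have "Ck_on k V (\<lambda>y. inverse (F y $ i) *s F y)" for k
  proof (rule Ck_on_vec[OF V(1)])
    have "Ck_on k V (\<lambda>y. inverse (F y $ i) * F y $ j)" for j
      using V_def by (intro Ck_on_mult Ck_on_inverse V(1) FV) blast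
    then show "Ck_on k V (\<lambda>y. (inverse (F y $ i) *s F y) $ j)" for j by simp
  qed
  moreover have "(affine_chart i \<circ> f) y = inverse (F y $ i) *s F y" if "y \<in> A \<inter> V" for y
    using that f[of y] V_def by (simp add: affine_chart_proj_point)
  ultimately have "smooth_map_on (A \<inter> V) (affine_chart i \<circ> f)"
    unfolding smooth_map_on_def using V(1)
    by (intro ballI exI[of _ V] exI[of _ "\<lambda>y. inverse (F y $ i) *s F y"]) auto
  moreover have "f ` (A \<inter> V) \<subseteq> chart_domain i"
    using f V_def by (auto intro!: proj_point_chart_domain)
  ultimately show "\<exists>i U. open U \<and> x \<in> U \<and> f ` (A \<inter> U) \<subseteq> chart_domain i \<and>
      smooth_map_on (A \<inter> U) (affine_chart i \<circ> f)"
    using V by blast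
qed

text \<open>The chart images of \<open>S\<close> lie in the cone over \<open>S\<close>, so a single
  statement on the cone restricts to every chart.\<close>

lemma smooth_from_projI:
  assumes "smooth_map_on {x. x \<noteq> 0 \<and> proj_point x \<in> S} (\<lambda>x. g (proj_point x))"
  shows "smooth_from_proj S g"
  unfolding smooth_from_proj_def
proof
  fix i
  have "w \<noteq> 0 \<and> proj_point w \<in> S" if "w \<in> affine_chart i ` (S \<inter> chart_domain i)" for w
  proof -
    from that obtain L where L: "L \<in> S" "L \<in> chart_domain i" "w = affine_chart i L" by blast
    then obtain x y where x: "x \<noteq> 0" "L = proj_point x" and y: "y \<in> L" "y $ i \<noteq> 0"
      unfolding chart_domain_def proj_space_def by blast
    then obtain c where "y = c *s x" by (auto simp: proj_point_eq_range)
    then have xi: "x $ i \<noteq> 0" using y(2) by auto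
    then have "w = inverse (x $ i) *s x"
      using L x by (simp add: affine_chart_proj_point)
    then show ?thesis
      using xi x L(1) by (simp add: proj_point_scale)
  qed
  then show "smooth_map_on (affine_chart i ` (S \<inter> chart_domain i)) (\<lambda>w. g (proj_point w))"
    by (intro smooth_map_on_subset[OF assms]) blast
qed

section \<open>The sphere as the projective line\<close>

text \<open>The inverse of stereographic projection in homogeneous coordinates, normalized so that
  \<open>[1 : 0]\<close> is the north pole.\<close>

definition hopf :: "complex \<Rightarrow> complex \<Rightarrow> real^3" where
  "hopf p q = (let N = p * cnj p + q * cnj q; \<alpha> = 2 * (cnj p * q) / N
     in vector [Re \<alpha>, Im \<alpha>, Re ((p * cnj p - q * cnj q) / N)])"

text \<open>Numerators and denominator all scale by |c|^2, which makes \<open>hopf\<close> a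
  function of the point [p : q].\<close>

lemma hopf_scale:
  assumes "c \<noteq> 0"
  shows "hopf (c * p) (c * q) = hopf p q"
proof -
  let ?d = "c * cnj c"
  have d: "?d \<noteq> 0" using assms by simp
  have 1: "c * p * cnj (c * p) + c * q * cnj (c * q) = ?d * (p * cnj p + q * cnj q)"
    and 2: "c * p * cnj (c * p) - c * q * cnj (c * q) = ?d * (p * cnj p - q * cnj q)"
    and 3: "2 * (cnj (c * p) * (c * q)) = ?d * (2 * (cnj p * q))"
    by (simp_all add: algebra_simps)
  show ?thesis
    unfolding hopf_def Let_def 1 2 3 mult_divide_mult_cancel_left[OF d] ..
qed

lemma norm_sq_sum_neq_0: "p \<noteq> 0 \<or> q \<noteq> 0 \<Longrightarrow> p * cnj p + q * cnj q \<noteq> 0"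
proof -
  assume pq: "p \<noteq> 0 \<or> q \<noteq> 0"
  have "p * cnj p + q * cnj q = of_real ((cmod p)\<^sup>2 + (cmod q)\<^sup>2)"
    by (simp only: complex_norm_square of_real_add)
  moreover have "(cmod p)\<^sup>2 + (cmod q)\<^sup>2 \<noteq> 0"
    using pq by (simp add: sum_power2_eq_zero_iff)
  ultimately show ?thesis by (simp only: of_real_eq_0_iff not_False_eq_True)
qed

lemma Ck_on_hopf:
  fixes p q :: "'a::euclidean_space \<Rightarrow> complex"
  assumes U: "open U" and nz: "\<And>x. x \<in> U \<Longrightarrow> p x \<noteq> 0 \<or> q x \<noteq> 0"
    and p: "Ck_on k U p" and q: "Ck_on k U q"
  shows "Ck_on k U (\<lambda>x. hopf (p x) (q x))"
proof -
  \<comment> \<open>\<open>hopf\<close> splits into real-linear images of complex-valued quotients,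
    to which the closure rules for products and inverses apply.\<close>
  define L1 :: "complex \<Rightarrow> real^3" where "L1 = (\<lambda>\<alpha>. vector [Re \<alpha>, Im \<alpha>, 0])"
  define L2 :: "complex \<Rightarrow> real^3" where "L2 = (\<lambda>\<beta>. vector [0, 0, Re \<beta>])"
  have L: "bounded_linear L1" "bounded_linear L2"
    unfolding linear_conv_bounded_linear[symmetric] L1_def L2_def
    by (intro linearI; simp add: vec_eq_iff forall_3)+
  have pc: "Ck_on k U (\<lambda>x. cnj (p x))" and qc: "Ck_on k U (\<lambda>x. cnj (q x))"
    using Ck_on_compose_bounded_linear[OF U bounded_linear_cnj] p q by blast+
  have minus: "Ck_on k U (\<lambda>x. f x - g x)" if "Ck_on k U f" "Ck_on k U g" for f g :: "'a \<Rightarrow> complex"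
    using Ck_on_add[OF U that(1) Ck_on_mult[OF U Ck_on_const[OF U, of k "-1"] that(2)]] by simp
  have inv: "Ck_on k U (\<lambda>x. inverse (p x * cnj (p x) + q x * cnj (q x)))"
    by (intro Ck_on_inverse Ck_on_add Ck_on_mult U p q pc qc norm_sq_sum_neq_0 nz)
  have "hopf (p x) (q x) = L1 (2 * (cnj (p x) * q x) * inverse (p x * cnj (p x) + q x * cnj (q x)))
     + L2 ((p x * cnj (p x) - q x * cnj (q x)) * inverse (p x * cnj (p x) + q x * cnj (q x)))" for x
    by (simp add: hopf_def Let_def L1_def L2_def vec_eq_iff forall_3 divide_inverse
        del: inverse_add complex_mult_cnj)
  then show ?thesis
    by (simp only:, intro Ck_on_add Ck_on_compose_bounded_linear[OF U L(1)]
        Ck_on_compose_bounded_linear[OF U L(2)] Ck_on_mult minus inv U p q pc qc Ck_on_const)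
qed

lemma sphere3_iff: "x \<in> sphere (0 :: real^3) 1 \<longleftrightarrow> (x $ 1)\<^sup>2 + (x $ 2)\<^sup>2 + (x $ 3)\<^sup>2 = 1"
  by (simp add: norm_vec_def L2_set_def sum_3)

text \<open>The first two coordinates are kept together as one complex number, so that identities on
  the sphere become computations with moduli.\<close>

lemma hopf_coords:
  assumes "p \<noteq> 0 \<or> q \<noteq> 0"
  defines "N \<equiv> (cmod p)\<^sup>2 + (cmod q)\<^sup>2"
  shows "Complex (hopf p q $ 1) (hopf p q $ 2) = 2 * (cnj p * q) / of_real N"
    and "hopf p q $ 3 = ((cmod p)\<^sup>2 - (cmod q)\<^sup>2) / N"
proof -
  have N: "p * cnj p + q * cnj q = of_real N"
    unfolding N_def by (simp only: complex_norm_square of_real_add)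
  show "Complex (hopf p q $ 1) (hopf p q $ 2) = 2 * (cnj p * q) / of_real N"
    unfolding hopf_def Let_def N vector_3 complex_surj ..
  have "p * cnj p - q * cnj q = of_real ((cmod p)\<^sup>2 - (cmod q)\<^sup>2)"
    by (simp only: complex_norm_square of_real_diff)
  then show "hopf p q $ 3 = ((cmod p)\<^sup>2 - (cmod q)\<^sup>2) / N"
    unfolding hopf_def Let_def N by (simp flip: of_real_divide)
qed

lemma hopf_in_sphere:
  assumes "p \<noteq> 0 \<or> q \<noteq> 0"
  shows "hopf p q \<in> sphere 0 1"
proof -
  define N where "N = (cmod p)\<^sup>2 + (cmod q)\<^sup>2"
  have N: "N \<noteq> 0" using assms by (simp add: N_def sum_power2_eq_zero_iff)
  have "(hopf p q $ 1)\<^sup>2 + (hopf p q $ 2)\<^sup>2 = (cmod (Complex (hopf p q $ 1) (hopf p q $ 2)))\<^sup>2"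
    by (simp add: cmod_power2)
  also have "\<dots> = 4 * (cmod p)\<^sup>2 * (cmod q)\<^sup>2 / N\<^sup>2"
    unfolding hopf_coords(1)[OF assms] N_def[symmetric]
    by (simp add: norm_divide norm_mult power_divide power_mult_distrib)
  finally have "(hopf p q $ 1)\<^sup>2 + (hopf p q $ 2)\<^sup>2 + (hopf p q $ 3)\<^sup>2
      = (4 * (cmod p)\<^sup>2 * (cmod q)\<^sup>2 + ((cmod p)\<^sup>2 - (cmod q)\<^sup>2)\<^sup>2) / N\<^sup>2"
    unfolding hopf_coords(2)[OF assms] N_def[symmetric] by (simp add: power_divide add_divide_distrib)
  also have "4 * (cmod p)\<^sup>2 * (cmod q)\<^sup>2 + ((cmod p)\<^sup>2 - (cmod q)\<^sup>2)\<^sup>2 = N\<^sup>2"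
    unfolding N_def by algebra
  finally show ?thesis unfolding sphere3_iff using N by simp
qed

lemma sphere3_cmod:
  assumes "x \<in> sphere (0 :: real^3) 1"
  shows "(cmod (Complex (x $ 1) (x $ 2)))\<^sup>2 = (1 + x $ 3) * (1 - x $ 3)"
  using assms unfolding sphere3_iff cmod_power2 complex.sel
  by (simp add: algebra_simps power2_eq_square)

lemma hopf_stereographic:
  assumes x: "x \<in> sphere (0 :: real^3) 1" and "x $ 3 \<noteq> - 1"
  shows "hopf (of_real (1 + x $ 3)) (Complex (x $ 1) (x $ 2)) = x"
proof -
  let ?z = "Complex (x $ 1) (x $ 2)" and ?h = "1 + x $ 3"
  have h: "?h \<noteq> 0" using assms(2) by auto
  have nz: "complex_of_real ?h \<noteq> 0 \<or> ?z \<noteq> 0" using h by (simp only: of_real_eq_0_iff simp_thms)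
  \<comment> \<open>With h = 1 + x_3 and |z|^2 = h (1 - x_3), the sum is h (h + 1 - x_3) = 2 h, and
    the difference is 2 h x_3.\<close>
  have N: "(cmod (of_real ?h))\<^sup>2 + (cmod ?z)\<^sup>2 = 2 * ?h"
    unfolding sphere3_cmod[OF x] norm_of_real power2_abs by algebra
  have D: "(cmod (of_real ?h))\<^sup>2 - (cmod ?z)\<^sup>2 = 2 * ?h * x $ 3"
    unfolding sphere3_cmod[OF x] norm_of_real power2_abs by algebra
  have "Complex (hopf (of_real ?h) ?z $ 1) (hopf (of_real ?h) ?z $ 2)
      = (2 * complex_of_real ?h * ?z) / (2 * complex_of_real ?h)"
    unfolding hopf_coords(1)[OF nz] N complex_cnj_complex_of_real of_real_mult of_real_numeral mult.assoc ..
  also have "\<dots> = ?z"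
    using h by (intro nonzero_mult_div_cancel_left) (simp only: mult_eq_0_iff of_real_eq_0_iff, simp)
  finally have "Complex (hopf (of_real ?h) ?z $ 1) (hopf (of_real ?h) ?z $ 2) = ?z" .
  then have "hopf (of_real ?h) ?z $ 1 = x $ 1" "hopf (of_real ?h) ?z $ 2 = x $ 2"
    by (simp_all only: complex.inject)
  moreover have "hopf (of_real ?h) ?z $ 3 = x $ 3"
    unfolding hopf_coords(2)[OF nz] N D using h by simp
  ultimately show ?thesis by (simp only: vec_eq_iff forall_3 simp_thms)
qed

lemma hopf_0_1: "q \<noteq> 0 \<Longrightarrow> hopf 0 q = vector [0, 0, -1]"
  by (simp add: hopf_def Let_def)

section \<open>The orbit of the highest weight line\<close>

lemma proportionalE:
  fixes a b a' b' :: "'a::field"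
  assumes "a \<noteq> 0 \<or> b \<noteq> 0" "a' \<noteq> 0 \<or> b' \<noteq> 0" "a * b' = a' * b"
  obtains c where "c \<noteq> 0" "a' = c * a" "b' = c * b"
proof (cases "a = 0")
  case True
  with assms show thesis by (intro that[of "b' / b"]) auto
next
  case False
  with assms show thesis
    by (intro that[of "a' / a"]) (auto simp: divide_simps mult.commute)
qed

context sl2_weight_basis
begin

lemma power_n: "x ^ n = x ^ (n - 1) * x" for x :: complex
  using n_pos power_minus_mult[of n x] by simp

lemma coord_0_curve: "coord 0 (curve a b) = a ^ (n - 1) * a"
  and coord_1_curve: "coord 1 (curve a b) = a ^ (n - 1) * b"
  using n_pos by (simp_all add: coord_curve power_n[of a])

text \<open>The factor \<open>of_nat n\<close> makes up for the step from
  \<open>fact (n - 1)\<close> to \<open>fact n\<close>, so that both quantities have the same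
  multiplier in front of \<open>a\<close> and \<open>b\<close>.\<close>

lemma coord_pred_curve: "coord (n - 1) (curve a b) = b ^ (n - 1) / fact (n - 1) * a"
  and coord_last_curve: "of_nat n * coord n (curve a b) = b ^ (n - 1) / fact (n - 1) * b"
  using n_pos fact_reduce[of n, where 'a=complex]
  by (simp_all add: coord_curve power_n[of b])

lemma curve_1_0: "curve 1 0 = v 0"
  by (simp add: curve_def power_0_left if_distrib[of "\<lambda>x. x / _"] if_distrib[of "\<lambda>c. c *s _"] cong: if_cong)

lemma curve_0_1: "curve 0 1 = (1 / fact n) *s v n"
proof -
  have "(\<Sum>j\<in>{..n} - {n}. (0 ^ (n - j) * 1 ^ j / fact j) *s v j) = 0"
    by (intro sum.neutral) auto
  then show ?thesis
    using sum.remove[of "{..n}" n "\<lambda>j. (0 ^ (n - j) * 1 ^ j / fact j) *s v j"]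
    by (simp add: curve_def)
qed

lemma proj_point_curve_eqI:
  assumes "a \<noteq> 0 \<or> b \<noteq> 0" "a' \<noteq> 0 \<or> b' \<noteq> 0" "a * b' = a' * b"
  shows "proj_point (curve a b) = proj_point (curve a' b')"
proof -
  obtain c where "c \<noteq> 0" "a' = c * a" "b' = c * b"
    using assms by (rule proportionalE)
  then show ?thesis by (simp add: curve_scale proj_point_scale)
qed

text \<open>Cross-multiplying the coordinates 0 and 1 eliminates the scalar \<open>c\<close>; the
  power product left to cancel is nonzero if \<open>a\<close> and \<open>a'\<close> are.\<close>

lemma proj_point_curve_eqD:
  assumes "a \<noteq> 0 \<or> b \<noteq> 0" "a' \<noteq> 0 \<or> b' \<noteq> 0" "proj_point (curve a b) = proj_point (curve a' b')"
  shows "a * b' = a' * b"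
proof -
  obtain c where c: "c \<noteq> 0" "curve a' b' = c *s curve a b"
    using assms by (metis proj_point_eqD curve_eq_zero_iff)
  define m where "m = n - 1"
  have 0: "a' ^ m * a' = c * (a ^ m * a)" and 1: "a' ^ m * b' = c * (a ^ m * b)"
    using arg_cong[OF c(2), of "coord 0"] arg_cong[OF c(2), of "coord 1"]
    by (simp_all only: coord_scale coord_0_curve coord_1_curve m_def)
  have "a' ^ m * a ^ m * (a * b') = (a ^ m * a) * (a' ^ m * b')" by (simp only: mult_ac)
  also have "\<dots> = (c * (a ^ m * a)) * (a ^ m * b)" unfolding 1 by (simp only: mult_ac)
  also have "\<dots> = a' ^ m * a ^ m * (a' * b)" unfolding 0[symmetric] by (simp only: mult_ac)
  finally have "a' ^ m * a ^ m * (a * b') = a' ^ m * a ^ m * (a' * b)" .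
  \<comment> \<open>By the equation of coordinate 0, \<open>a\<close> and \<open>a'\<close> vanish
    together, and then both sides are 0.\<close>
  then show ?thesis using 0 c(1) by (cases "a = 0"; cases "a' = 0") auto
qed

section \<open>Exponentials acting on the curve\<close>

lemma mat_exp_Y: "mat_exp (mat_scale z (\<rho> sl_Y)) *v v 0 = curve 1 z"
proof -
  have "sl_elem 0 0 z = mat_scale z sl_Y"
    by (simp add: sl_elem_def vec_eq_iff map_matrix_def)
  \<comment> \<open>The path (1, z t) solves the system of \<open>sl_elem 0 0 z\<close>; the
    products \<open>z * 0\<close> and \<open>z * 1\<close> let unification see its two ends.\<close>
  moreover have "mat_exp (\<rho> (sl_elem 0 0 z)) *v curve 1 (z * 0) = curve 1 (z * 1)"
    by (rule mat_exp_curve[where a="\<lambda>_. 1"]) (auto intro!: derivative_eq_intros)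
  ultimately show ?thesis by (simp add: curve_1_0 rho_scale sl_basis)
qed

lemma mat_exp_X: "mat_exp (mat_scale w (\<rho> sl_X)) *v v n = fact n *s curve w 1"
proof -
  have "v n = fact n *s curve 0 1"
    by (simp add: curve_0_1 vector_smult_assoc)
  moreover have "sl_elem 0 w 0 = mat_scale w sl_X"
    by (simp add: sl_elem_def vec_eq_iff map_matrix_def)
  moreover have "mat_exp (\<rho> (sl_elem 0 w 0)) *v curve (w * 0) 1 = curve (w * 1) 1"
    by (rule mat_exp_curve[where b="\<lambda>_. 1"]) (auto intro!: derivative_eq_intros)
  ultimately show ?thesis by (simp add: vec.scale rho_scale sl_basis)
qed

lemma mat_exp_preserves_curve:
  assumes "A \<in> sl" "a \<noteq> 0 \<or> b \<noteq> 0"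
  shows "\<exists>a' b'. (a' \<noteq> 0 \<or> b' \<noteq> 0) \<and> mat_exp (\<rho> A) *v curve a b = curve a' b'"
proof -
  obtain h x y where A: "A = sl_elem h x y"
    using sl_eq_sl_elem[OF assms(1)] .
  \<comment> \<open>The path e^(tA) applied to (a, b) solves the linear system on pairs, so its
    endpoint provides \<open>a'\<close> and \<open>b'\<close>.\<close>
  define w where "w t = mat_exp (mat_scale t A) *v vector [a, b]" for t
  have w': "((\<lambda>t. w t $ i) has_field_derivative (A *v w t) $ i) (at t)" for t i
    unfolding w_def by (rule mat_exp_has_derivative)
  have "(A *v u) $ 1 = h * u $ 1 + x * u $ 2" "(A *v u) $ 2 = y * u $ 1 - h * u $ 2" for u
    by (simp_all add: A sl_elem_def matrix_vector_mult_nth sum_2 map_matrix_def sl_H_def sl_X_def sl_Y_def)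
  then have "mat_exp (\<rho> A) *v curve (w 0 $ 1) (w 0 $ 2) = curve (w 1 $ 1) (w 1 $ 2)"
    using w'[of 1] w'[of 2] unfolding A by (intro mat_exp_curve) simp_all
  moreover have "mat_scale 0 A = 0"
    by (simp add: vec_eq_iff map_matrix_def)
  then have "w 0 = vector [a, b]"
    by (simp add: w_def mat_exp_0)
  ultimately have eq: "mat_exp (\<rho> A) *v curve a b = curve (w 1 $ 1) (w 1 $ 2)" by simp
  \<comment> \<open>Invertibility of the exponential excludes the value 0, hence the endpoint pair
    is nonzero.\<close>
  have "mat_exp (- \<rho> A) *v (mat_exp (\<rho> A) *v curve a b) = curve a b"
    by (simp add: matrix_vector_mul_assoc mat_exp_minus)
  then have "mat_exp (\<rho> A) *v curve a b \<noteq> 0"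
    using assms(2) curve_eq_zero_iff by auto
  with eq show ?thesis by (metis curve_eq_zero_iff)
qed

text \<open>The nonzero values of F form a set invariant under the exponentials, hence under the
  group. Conversely, exponentials of multiples of Y reach every point with
  \<open>a \<noteq> 0\<close>, and a quarter turn reaches the last one.\<close>

lemma orbit_eq: "highest_weight_orbit \<rho> v = {proj_point (curve a b) |a b. a \<noteq> 0 \<or> b \<noteq> 0}"
proof
  show "highest_weight_orbit \<rho> v \<subseteq> {proj_point (curve a b) |a b. a \<noteq> 0 \<or> b \<noteq> 0}"
  proof
    fix L assume "L \<in> highest_weight_orbit \<rho> v"
    then obtain g where g: "g \<in> exp_group \<rho>" "L = proj_point (g *v v 0)"
      by (auto simp: highest_weight_orbit_def proj_orbit_def matrix_image_proj_point)
    have "g *v v 0 \<in> {curve a b |a b. a \<noteq> 0 \<or> b \<noteq> 0}"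
    proof (rule exp_group_invariant[OF representation _ g(1)])
      show "mat_exp (\<rho> A) *v x \<in> {curve a b |a b. a \<noteq> 0 \<or> b \<noteq> 0}"
        if "A \<in> sl" "x \<in> {curve a b |a b. a \<noteq> 0 \<or> b \<noteq> 0}" for A x
        using that mat_exp_preserves_curve by blast
      show "v 0 \<in> {curve a b |a b. a \<noteq> 0 \<or> b \<noteq> 0}"
        using curve_1_0[symmetric] by force
    qed
    then obtain a b where "a \<noteq> 0 \<or> b \<noteq> 0" "g *v v 0 = curve a b" by blast
    then show "L \<in> {proj_point (curve a b) |a b. a \<noteq> 0 \<or> b \<noteq> 0}"
      using g(2) by auto
  qed
  have exp: "proj_point (mat_exp (\<rho> A) *v v 0) \<in> highest_weight_orbit \<rho> v" if "A \<in> sl" for A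
  proof -
    have "mat_exp (\<rho> A) \<in> exp_group \<rho>"
      unfolding exp_group_def using that by (intro generate.incl) blast
    then show ?thesis
      unfolding highest_weight_orbit_def proj_orbit_def matrix_image_proj_point[symmetric] by blast
  qed
  have "proj_point (curve a b) \<in> highest_weight_orbit \<rho> v" if "a \<noteq> 0 \<or> b \<noteq> 0" for a b
  proof (cases "a = 0")
    case True
    \<comment> \<open>The exponential of (pi/2) (Y - X): its path (cos, sin) turns (1, 0) into (0,
      1).\<close>
    have "mat_exp (\<rho> (sl_elem 0 (- of_real (pi / 2)) (of_real (pi / 2)))) *v
        curve (cos (of_real (pi / 2) * 0)) (sin (of_real (pi / 2) * 0)) =
        curve (cos (of_real (pi / 2) * 1)) (sin (of_real (pi / 2) * 1))"
      by (rule mat_exp_curve) (auto intro!: derivative_eq_intros)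
    then have "mat_exp (\<rho> (sl_elem 0 (- of_real (pi / 2)) (of_real (pi / 2)))) *v v 0 = curve 0 1"
      by (simp add: curve_1_0 cos_of_real sin_of_real del: of_real_divide)
    moreover have "proj_point (curve a b) = proj_point (curve 0 1)"
      using True that by (intro proj_point_curve_eqI) auto
    ultimately show ?thesis using exp[OF sl_elem_in_sl] by metis
  next
    case False
    have "mat_exp (\<rho> (mat_scale (b / a) sl_Y)) *v v 0 = curve 1 (b / a)"
      using mat_exp_Y by (simp add: rho_scale sl_basis)
    moreover have "proj_point (curve a b) = proj_point (curve 1 (b / a))"
      using False by (intro proj_point_curve_eqI) auto
    ultimately show ?thesis using exp[OF sl_scale[OF sl_basis(3)]] by metis
  qed
  then show "{proj_point (curve a b) |a b. a \<noteq> 0 \<or> b \<noteq> 0} \<subseteq> highest_weight_orbit \<rho> v"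
    by blast
qed

lemma in_orbitE:
  assumes "L \<in> highest_weight_orbit \<rho> v"
  obtains a b where "a \<noteq> 0 \<or> b \<noteq> 0" "L = proj_point (curve a b)"
  using assms unfolding orbit_eq by blast

lemma curve_in_orbit: "a \<noteq> 0 \<or> b \<noteq> 0 \<Longrightarrow> proj_point (curve a b) \<in> highest_weight_orbit \<rho> v"
  unfolding orbit_eq by blast

lemma orbit_subset_proj_space: "highest_weight_orbit \<rho> v \<subseteq> proj_space"
  unfolding orbit_eq proj_space_def using curve_eq_zero_iff by blast

lemma cone_orbitE:
  assumes "x \<noteq> 0" "proj_point x \<in> highest_weight_orbit \<rho> v"
  obtains c a b where "c \<noteq> 0" "a \<noteq> 0 \<or> b \<noteq> 0" "x = c *s curve a b"
  using assms by (metis in_orbitE proj_point_eqD)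

section \<open>From the orbit to the sphere\<close>

text \<open>The definite description is meaningful only on the orbit.\<close>

definition orbit_to_sphere :: "(complex^'n) set \<Rightarrow> real^3" where
  "orbit_to_sphere L =
     (THE y. \<exists>a b. (a \<noteq> 0 \<or> b \<noteq> 0) \<and> L = proj_point (curve a b) \<and> y = hopf a b)"

text \<open>Two representatives of one point are proportional and \<open>hopf\<close> ignores a
  common factor, so the description is unique.\<close>

lemma orbit_to_sphere_curve:
  assumes "a \<noteq> 0 \<or> b \<noteq> 0"
  shows "orbit_to_sphere (proj_point (curve a b)) = hopf a b"
  unfolding orbit_to_sphere_def
proof (rule the_equality)
  fix y assume "\<exists>a' b'. (a' \<noteq> 0 \<or> b' \<noteq> 0) \<and> proj_point (curve a b) = proj_point (curve a' b') \<and> y = hopf a' b'"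
  then obtain a' b' where ab': "a' \<noteq> 0 \<or> b' \<noteq> 0" "proj_point (curve a b) = proj_point (curve a' b')"
    and y: "y = hopf a' b'" by blast
  then obtain c where "c \<noteq> 0" "a' = c * a" "b' = c * b"
    using proportionalE[OF assms ab'(1)] proj_point_curve_eqD[OF assms ab'] by metis
  then show "y = hopf a b" using y by (simp add: hopf_scale)
qed (use assms in blast)

text \<open>On \<open>x = c F(a, b)\<close> the coordinates \<open>(x\<^sub>0, x\<^sub>1)\<close> and \<open>(x\<^bsub>n-1\<^esub>, n x\<^sub>n)\<close> are both proportional to \<open>(a, b)\<close>;
  the first pair is nonzero where \<open>a \<noteq> 0\<close>, the second where \<open>b \<noteq> 0\<close>.\<close>

lemma smooth_orbit_to_sphere:
  "smooth_map_on {x. x \<noteq> 0 \<and> proj_point x \<in> highest_weight_orbit \<rho> v} (\<lambda>x. orbit_to_sphere (proj_point x))"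
  (is "smooth_map_on ?E _")
  unfolding smooth_map_on_def
proof
  \<comment> \<open>Both cases share one argument: coordinate \<open>i\<close> cuts out the open
    set, and \<open>r * coord j\<close>, \<open>s * coord l\<close> serve as homogeneous coordinates
    [a : b] on it.\<close>
  have smooth: "\<exists>U F. open U \<and> x \<in> U \<and> (\<forall>k. Ck_on k U F) \<and> (\<forall>y\<in>?E \<inter> U. F y = orbit_to_sphere (proj_point y))"
    if x: "coord i x \<noteq> 0"
      and ij: "\<And>a b. a \<noteq> 0 \<or> b \<noteq> 0 \<Longrightarrow> coord i (curve a b) \<noteq> 0 \<Longrightarrow> \<exists>e. e \<noteq> 0 \<and>
          r * coord j (curve a b) = e * a \<and> s * coord l (curve a b) = e * b"
      and il: "\<And>x. coord i x \<noteq> 0 \<Longrightarrow> r * coord j x \<noteq> 0 \<or> s * coord l x \<noteq> 0" for x i j l r s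
  proof (intro exI conjI allI ballI)
    have coordC: "Ck_on k U (coord j)" if "open U" for U k j
      using Ck_on_bounded_linear[OF that bounded_linear_coord] .
    show U: "open (coord i -` (- {0}))"
      using coordC[of UNIV 0 i] by (intro open_vimage) auto
    show "x \<in> coord i -` (- {0})" using x by simp
    show "Ck_on k (coord i -` (- {0})) (\<lambda>x. hopf (r * coord j x) (s * coord l x))" for k
      using il by (intro Ck_on_hopf U Ck_on_mult Ck_on_const coordC) auto
    fix y assume y: "y \<in> ?E \<inter> coord i -` (- {0})"
    then obtain c a b where cab: "c \<noteq> 0" "a \<noteq> 0 \<or> b \<noteq> 0" "y = c *s curve a b"
      using cone_orbitE by blast
    with y obtain e where e: "e \<noteq> 0" "r * coord j (curve a b) = e * a" "s * coord l (curve a b) = e * b"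
      using ij[OF cab(2)] by (auto simp: coord_scale)
    have "hopf (r * coord j y) (s * coord l y) = hopf (c * (r * coord j (curve a b))) (c * (s * coord l (curve a b)))"
      by (simp add: cab(3) coord_scale mult_ac)
    also have "\<dots> = orbit_to_sphere (proj_point y)"
      unfolding e using cab e(1) by (simp add: hopf_scale proj_point_scale orbit_to_sphere_curve)
    finally show "hopf (r * coord j y) (s * coord l y) = orbit_to_sphere (proj_point y)" .
  qed
  fix x assume "x \<in> ?E"
  then obtain c a b where cab: "c \<noteq> 0" "a \<noteq> 0 \<or> b \<noteq> 0" "x = c *s curve a b"
    using cone_orbitE by blast
  show "\<exists>U F. open U \<and> x \<in> U \<and> (\<forall>k. Ck_on k U F) \<and> (\<forall>y\<in>?E \<inter> U. F y = orbit_to_sphere (proj_point y))"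
  proof (cases "a = 0")
    case False
    show ?thesis
    proof (rule smooth[of 0 _ 1 0 1 1])
      show "coord 0 x \<noteq> 0" using False cab by (simp add: coord_scale coord_curve)
      show "\<exists>e. e \<noteq> 0 \<and> 1 * coord 0 (curve a b) = e * a \<and> 1 * coord 1 (curve a b) = e * b"
        if "coord 0 (curve a b) \<noteq> 0" for a b
        using that unfolding coord_0_curve coord_1_curve
        by (intro exI[of _ "a ^ (n - 1)"]) auto
    qed simp
  next
    case True
    show ?thesis
    proof (rule smooth[of n _ 1 "n - 1" "of_nat n" n])
      show "coord n x \<noteq> 0" using True cab by (simp add: coord_scale coord_curve)
      show "\<exists>e. e \<noteq> 0 \<and> 1 * coord (n - 1) (curve a b) = e * a \<and> of_nat n * coord n (curve a b) = e * b"
        if "coord n (curve a b) \<noteq> 0" for a b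
      proof (intro exI conjI)
        have "of_nat n * coord n (curve a b) \<noteq> 0" using that n_pos by simp
        then show "b ^ (n - 1) / fact (n - 1) \<noteq> 0" unfolding coord_last_curve by auto
      qed (simp_all only: coord_pred_curve coord_last_curve mult_1)
    qed (use n_pos in simp)
  qed
qed

end

section \<open>The diffeomorphism with the sphere\<close>

context sl2_weight_basis
begin

text \<open>\<open>[1 + x\<^sub>3 : x\<^sub>1 + i x\<^sub>2]\<close> is stereographic projection from the south pole; at the south pole itself
  this pair vanishes, and near it \<open>[x\<^sub>1 - i x\<^sub>2 : 1 - x\<^sub>3]\<close> is the same point.\<close>

definition sphere_to_orbit :: "real^3 \<Rightarrow> (complex^'n) set" where
  "sphere_to_orbit x =
     (if x $ 3 = - 1 then proj_point (curve 0 1)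
      else proj_point (curve (of_real (1 + x $ 3)) (Complex (x $ 1) (x $ 2))))"

text \<open>Away from the poles the two pairs are proportional because |x_1 + i x_2|^2 = (1 + x_3)
  (1 - x_3); at the south pole the new pair is (0, 2).\<close>

lemma sphere_to_orbit_near_south_pole:
  assumes "x \<in> sphere 0 1" "x $ 3 \<noteq> 1"
  shows "sphere_to_orbit x = proj_point (curve (cnj (Complex (x $ 1) (x $ 2))) (of_real (1 - x $ 3)))"
proof (cases "x $ 3 = - 1")
  case True
  then have "Complex (x $ 1) (x $ 2) = 0"
    using sphere3_cmod[OF assms(1)] by simp
  then have "proj_point (curve (cnj (Complex (x $ 1) (x $ 2))) (of_real (1 - x $ 3))) = proj_point (curve 0 1)"
    using True by (intro proj_point_curve_eqI) auto
  then show ?thesis by (simp add: sphere_to_orbit_def True)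
next
  case False
  have "complex_of_real (1 + x $ 3) * of_real (1 - x $ 3) = cnj (Complex (x $ 1) (x $ 2)) * Complex (x $ 1) (x $ 2)"
    unfolding of_real_mult[symmetric] sphere3_cmod[OF assms(1), symmetric] complex_norm_square by (rule mult.commute)
  moreover have "complex_of_real (1 + x $ 3) \<noteq> 0" "complex_of_real (1 - x $ 3) \<noteq> 0"
    unfolding of_real_eq_0_iff using False assms(2) by auto
  ultimately have "proj_point (curve (of_real (1 + x $ 3)) (Complex (x $ 1) (x $ 2)))
      = proj_point (curve (cnj (Complex (x $ 1) (x $ 2))) (of_real (1 - x $ 3)))"
    by (intro proj_point_curve_eqI) blast+
  then show ?thesis using False by (simp add: sphere_to_orbit_def)
qed

lemma Ck_on_curve:
  assumes "open U" "Ck_on k U p" "Ck_on k U q"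
  shows "Ck_on k U (\<lambda>x. curve (p x) (q x))"
  unfolding curve_def divide_inverse
  by (intro Ck_on_sum Ck_on_compose_bounded_linear[OF _ bounded_linear_vscale] Ck_on_mult
      Ck_on_power Ck_on_const assms)

lemma smooth_sphere_to_orbit: "smooth_to_proj (sphere 0 1) sphere_to_orbit"
proof (rule smooth_to_projI)
  fix x :: "real^3" assume x: "x \<in> sphere 0 1"
  have height: "Ck_on k U (\<lambda>y :: real^3. of_real (1 + y $ 3) :: complex)"
    "Ck_on k U (\<lambda>y :: real^3. of_real (1 - y $ 3) :: complex)" if "open U" for k U
  proof -
    have L: "bounded_linear (\<lambda>y :: real^3. of_real (y $ 3) :: complex)"
      by (rule bounded_linear_compose[OF bounded_linear_of_real bounded_linear_vec_nth])
    show "Ck_on k U (\<lambda>y :: real^3. of_real (1 + y $ 3) :: complex)"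
      using Ck_on_add[OF that Ck_on_const[OF that] Ck_on_bounded_linear[OF that L], of k 1] by simp
    show "Ck_on k U (\<lambda>y :: real^3. of_real (1 - y $ 3) :: complex)"
      using Ck_on_add[OF that Ck_on_const[OF that]
          Ck_on_bounded_linear[OF that bounded_linear_minus[OF L]], of k 1] by simp
  qed
  have plane: "Ck_on k U (\<lambda>y :: real^3. Complex (y $ 1) (y $ 2))"
    "Ck_on k U (\<lambda>y :: real^3. cnj (Complex (y $ 1) (y $ 2)))" if "open U" for k U
    by (intro Ck_on_bounded_linear that; simp add: linear_conv_bounded_linear[symmetric] linear_iff complex_eq_iff)+
  have open_height: "open {y :: real^3. y $ 3 \<noteq> c}" for c
    by (intro open_Collect_neq continuous_intros)
  show "\<exists>U F. open U \<and> x \<in> U \<and> (\<forall>k. Ck_on k U F) \<and> F x \<noteq> 0 \<and>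
    (\<forall>y\<in>sphere 0 1 \<inter> U. sphere_to_orbit y = proj_point (F y))"
  proof (cases "x $ 3 = - 1")
    case True
    show ?thesis
    proof (intro exI conjI allI ballI)
      show "open {y :: real^3. y $ 3 \<noteq> 1}" by (rule open_height)
      then show "Ck_on k {y :: real^3. y $ 3 \<noteq> 1}
          (\<lambda>y. curve (cnj (Complex (y $ 1) (y $ 2))) (of_real (1 - y $ 3)))" for k
        by (intro Ck_on_curve plane height)
      show "x \<in> {y. y $ 3 \<noteq> 1}" using True by simp
      show "curve (cnj (Complex (x $ 1) (x $ 2))) (of_real (1 - x $ 3)) \<noteq> 0"
        using True by (simp add: curve_eq_zero_iff)
    qed (simp add: sphere_to_orbit_near_south_pole)
  next
    case False
    show ?thesis
    proof (intro exI conjI allI ballI)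
      show "open {y :: real^3. y $ 3 \<noteq> - 1}" by (rule open_height)
      then show "Ck_on k {y :: real^3. y $ 3 \<noteq> - 1}
          (\<lambda>y. curve (of_real (1 + y $ 3)) (Complex (y $ 1) (y $ 2)))" for k
        by (intro Ck_on_curve plane height)
      show "x \<in> {y. y $ 3 \<noteq> - 1}" using False by simp
      show "curve (of_real (1 + x $ 3)) (Complex (x $ 1) (x $ 2)) \<noteq> 0"
        unfolding curve_eq_zero_iff of_real_eq_0_iff using False by auto
    qed (simp add: sphere_to_orbit_def)
  qed
qed

lemma sphere_to_orbit_in_orbit: "sphere_to_orbit x \<in> highest_weight_orbit \<rho> v"
proof -
  have "complex_of_real (1 + x $ 3) \<noteq> 0" if "x $ 3 \<noteq> - 1"
    unfolding of_real_eq_0_iff using that by auto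
  then show ?thesis
    unfolding sphere_to_orbit_def by (auto intro!: curve_in_orbit simp del: of_real_add)
qed

lemma orbit_to_sphere_to_orbit:
  assumes "x \<in> sphere 0 1"
  shows "orbit_to_sphere (sphere_to_orbit x) = x"
proof (cases "x $ 3 = - 1")
  case True
  have "x $ 1 = 0" "x $ 2 = 0"
    using assms True unfolding sphere3_iff by (simp_all add: sum_power2_eq_zero_iff)
  then show ?thesis
    using True by (simp add: sphere_to_orbit_def orbit_to_sphere_curve hopf_0_1 vec_eq_iff forall_3)
next
  case False
  then have "complex_of_real (1 + x $ 3) \<noteq> 0" unfolding of_real_eq_0_iff by auto
  then show ?thesis
    using False assms by (simp add: sphere_to_orbit_def orbit_to_sphere_curve hopf_stereographic del: of_real_add)
qed

lemma sphere_to_orbit_to_sphere: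
  assumes "L \<in> highest_weight_orbit \<rho> v"
  shows "orbit_to_sphere L \<in> sphere 0 1" "sphere_to_orbit (orbit_to_sphere L) = L"
proof -
  obtain a b where ab: "a \<noteq> 0 \<or> b \<noteq> 0" and L: "L = proj_point (curve a b)"
    using in_orbitE[OF assms] .
  have y: "orbit_to_sphere L = hopf a b"
    using ab L orbit_to_sphere_curve by simp
  show "orbit_to_sphere L \<in> sphere 0 1"
    unfolding y using ab by (rule hopf_in_sphere)
  define N where "N = (cmod a)\<^sup>2 + (cmod b)\<^sup>2"
  have N: "N \<noteq> 0" using ab by (simp add: N_def sum_power2_eq_zero_iff)
  \<comment> \<open>This height above the south pole vanishes exactly for \<open>a = 0\<close> and
    so decides which branch of \<open>sphere_to_orbit\<close> applies.\<close>
  have h: "1 + hopf a b $ 3 = 2 * (cmod a)\<^sup>2 / N"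
    unfolding hopf_coords(2)[OF ab] N_def[symmetric] using N by (simp add: field_simps N_def)
  show "sphere_to_orbit (orbit_to_sphere L) = L"
  proof (cases "a = 0")
    case True
    then have "hopf a b $ 3 = - 1" using h by simp
    moreover have "proj_point (curve 0 1) = L"
      unfolding L using True ab by (intro proj_point_curve_eqI) auto
    ultimately show ?thesis by (simp add: y sphere_to_orbit_def)
  next
    case False
    then have h0: "1 + hopf a b $ 3 \<noteq> 0" using h N by simp
    then have "hopf a b $ 3 \<noteq> - 1" by auto
    moreover have "proj_point (curve (of_real (1 + hopf a b $ 3)) (Complex (hopf a b $ 1) (hopf a b $ 2))) = L"
      unfolding L
    proof (rule proj_point_curve_eqI)
      show "complex_of_real (1 + hopf a b $ 3) \<noteq> 0 \<or> Complex (hopf a b $ 1) (hopf a b $ 2) \<noteq> 0"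
        using h0 of_real_eq_0_iff by blast
      show "complex_of_real (1 + hopf a b $ 3) * b = a * Complex (hopf a b $ 1) (hopf a b $ 2)"
        unfolding h hopf_coords(1)[OF ab] N_def[symmetric] of_real_divide of_real_mult complex_norm_square
        by simp
    qed fact
    ultimately show ?thesis by (simp add: y sphere_to_orbit_def)
  qed
qed

theorem diffeomorphic_sphere_orbit: "diffeomorphic_proj (sphere (0 :: real^3) 1) (highest_weight_orbit \<rho> v)"
  unfolding diffeomorphic_proj_def
  using orbit_subset_proj_space smooth_sphere_to_orbit smooth_from_projI[OF smooth_orbit_to_sphere]
    sphere_to_orbit_in_orbit orbit_to_sphere_to_orbit sphere_to_orbit_to_sphere by blast

end

section \<open>The class of the tautological bundle\<close>

lemma open_map_proj_point: "open_map (top_of_set (- {0 :: complex^'n})) proj_topology proj_point"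
  unfolding open_map_def
proof (intro allI impI)
  fix U :: "(complex^'n) set" assume "openin (top_of_set (- {0})) U"
  then have U: "open U" "U \<subseteq> - {0}"
    by (simp_all add: openin_open_eq open_Compl)
  \<comment> \<open>The saturation of \<open>U\<close> is the union of its multiples by nonzero
    scalars, each of them open.\<close>
  have "{x. x \<noteq> 0 \<and> proj_point x \<in> proj_point ` U} = (\<Union>c\<in>- {0}. (\<lambda>x. c *s x) -` U)"
  proof (intro subset_antisym subsetI)
    fix x assume "x \<in> {x. x \<noteq> 0 \<and> proj_point x \<in> proj_point ` U}"
    then obtain u where u: "u \<in> U" "proj_point x = proj_point u" by blast
    with U(2) obtain c where "c \<noteq> 0" "u = c *s x" using proj_point_eqD by blast
    then show "x \<in> (\<Union>c\<in>- {0}. (\<lambda>x. c *s x) -` U)" using u(1) by auto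
  next
    fix x assume "x \<in> (\<Union>c\<in>- {0}. (\<lambda>x. c *s x) -` U)"
    then obtain c where c: "c \<noteq> 0" "c *s x \<in> U" by auto
    then have "proj_point x \<in> proj_point ` U"
      using proj_point_scale[OF c(1), of x] by (metis imageI)
    moreover have "x \<noteq> 0" using c U(2) by auto
    ultimately show "x \<in> {x. x \<noteq> 0 \<and> proj_point x \<in> proj_point ` U}" by simp
  qed
  moreover have "open ((\<lambda>x. c *s x) -` U)" for c
    by (intro open_vimage U(1) linear_continuous_on)
      (simp add: linear_conv_bounded_linear[symmetric] linear_iff vec_eq_iff algebra_simps)
  moreover have "proj_point ` U \<subseteq> proj_space"
    using U(2) unfolding proj_space_def by blast
  ultimately show "openin proj_topology (proj_point ` U)"
    unfolding openin_proj_topology by (simp add: open_UN)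
qed

text \<open>Open maps, unlike quotient maps in general, restrict to the full preimage of any subset;
  hence the detour through openness.\<close>

lemma quotient_map_taut_total:
  fixes S :: "(complex^'n) set set"
  assumes "S \<subseteq> proj_space"
  shows "quotient_map (taut_total S) (subtopology proj_topology S) proj_point"
proof -
  have E: "taut_total S = subtopology (top_of_set (- {0})) {x. x \<noteq> 0 \<and> proj_point x \<in> S}"
    unfolding taut_total_def subtopology_subtopology by (rule arg_cong[where f="subtopology _"]) auto
  show ?thesis
  proof (rule continuous_open_imp_quotient_map)
    show "continuous_map (taut_total S) (subtopology proj_topology S) proj_point"
      unfolding E
      by (intro continuous_map_into_subtopology continuous_map_from_subtopology
          quotient_imp_continuous_map quotient_map_proj_point) auto
    show "open_map (taut_total S) (subtopology proj_topology S) proj_point"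
      unfolding E by (intro open_map_restriction open_map_proj_point) auto
    show "proj_point ` topspace (taut_total S) = topspace (subtopology proj_topology S)"
      using assms unfolding taut_total_def topspace_subtopology topspace_proj_topology proj_space_def by auto
  qed
qed

section \<open>Clutching functions and winding numbers\<close>

lemma trivial_line_bundle_clutching:
  assumes triv: "trivial_line_bundle E B p s" and h: "hemispheres B h1 h2"
    and s1: "\<And>e. s 1 e = e"
  shows "clutching_function E B p s h1 h2 (\<lambda>_. 1)"
proof -
  obtain \<phi> where \<phi>: "homeomorphic_map (prod_topology B (top_of_set (- {0}))) E \<phi>"
    and "\<forall>b\<in>topspace B. \<forall>c\<in>- {0}. p (\<phi> (b, c)) = b \<and> (\<forall>d\<in>- {0}. \<phi> (b, d * c) = s d (\<phi> (b, c)))"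
    using triv unfolding trivial_line_bundle_def by (elim exE conjE)
  then have p: "p (\<phi> (b, 1)) = b" if "b \<in> topspace B" for b
    using that by simp
  \<comment> \<open>The image of the constant 1 is a global section; over the equator it is compared
    with itself.\<close>
  have "continuous_map B E (\<phi> \<circ> (\<lambda>b. (b, 1)))"
    by (intro continuous_map_compose[OF _ homeomorphic_imp_continuous_map[OF \<phi>]])
      (simp add: continuous_map_pairedI)
  then have "section_over E B p D (\<phi> \<circ> (\<lambda>b. (b, 1)))" if "D \<subseteq> topspace B" for D
    using that p unfolding section_over_def by (auto intro: continuous_map_from_subtopology)
  moreover have "h1 ` cball 0 1 \<subseteq> topspace B" "h2 ` cball 0 1 \<subseteq> topspace B"
    using h unfolding hemispheres_def by blast+
  ultimately show ?thesis
    unfolding clutching_function_def using s1 by (intro conjI exI[of _ "\<phi> \<circ> (\<lambda>b. (b, 1))"]) auto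
qed

lemma embedding_map_inverseE:
  assumes "embedding_map X Y f"
  obtains g where "continuous_map (subtopology Y (f ` topspace X)) X g" "\<And>x. x \<in> topspace X \<Longrightarrow> g (f x) = x"
  using assms unfolding embedding_map_def homeomorphic_map_maps homeomorphic_maps_def by blast

text \<open>The logarithms of \<open>u1\<close> and \<open>u2\<close> on the disc contribute nothing to the winding number.\<close>

lemma winding_number_clutching:
  fixes a u1 u2 :: "complex \<Rightarrow> complex"
  assumes u1: "continuous_on (cball 0 1) u1" "\<And>z. z \<in> cball 0 1 \<Longrightarrow> u1 z \<noteq> 0"
    and u2: "continuous_on (cball 0 1) u2" "\<And>z. z \<in> cball 0 1 \<Longrightarrow> u2 z \<noteq> 0"
    and a: "\<And>w. w \<in> sphere 0 1 \<Longrightarrow> a w * u1 (1 / w) = w ^ n * u2 w"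
  shows "winding_number (a \<circ> circlepath 0 1) 0 = of_nat n"
proof -
  obtain g1 where g1: "continuous_on (cball 0 1) g1" "\<And>z. z \<in> cball 0 1 \<Longrightarrow> u1 z = exp (g1 z)"
    using continuous_logarithm_on_cball[OF u1] by blast
  obtain g2 where g2: "continuous_on (cball 0 1) g2" "\<And>z. z \<in> cball 0 1 \<Longrightarrow> u2 z = exp (g2 z)"
    using continuous_logarithm_on_cball[OF u2] by blast
  define c where "c t = exp (2 * of_real pi * \<i> * complex_of_real t)" for t :: real
  have c: "circlepath 0 1 t = c t" for t by (simp add: circlepath c_def)
  have norm_c: "norm (c t) = 1" for t by (simp add: c_def norm_exp_eq_Re)
  have inv_c: "1 / c t = exp (- (2 * of_real pi * \<i> * complex_of_real t))" for t
    by (simp add: c_def exp_minus divide_inverse)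
  \<comment> \<open>A logarithm of \<open>a\<close> along the circle. At both ends \<open>c\<close>
    takes the value 1, so the contributions of \<open>g1\<close> and \<open>g2\<close> cancel and
    the increment is n times 2 pi i.\<close>
  define p where "p t = of_nat n * (2 * of_real pi * \<i> * complex_of_real t) + g2 (c t) - g1 (1 / c t)" for t :: real
  have norm_inv_c: "norm (1 / c t) = 1" for t by (simp add: norm_divide norm_c)
  have "path p"
    unfolding path_def p_def inv_c unfolding c_def
  proof (intro continuous_intros continuous_on_compose2[OF g1(1)] continuous_on_compose2[OF g2(1)])
    show "(\<lambda>t. exp (2 * of_real pi * \<i> * complex_of_real t)) ` {0..1} \<subseteq> cball 0 1"
      using norm_c unfolding c_def by auto
    show "(\<lambda>t. exp (- (2 * of_real pi * \<i> * complex_of_real t))) ` {0..1} \<subseteq> cball 0 1"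
      using norm_inv_c unfolding inv_c by auto
  qed
  then have "winding_number (exp \<circ> p) 0 = (pathfinish p - pathstart p) / (2 * of_real pi * \<i>)"
    by (rule winding_number_compose_exp)
  moreover have "pathfinish p - pathstart p = of_nat n * (2 * of_real pi * \<i>)"
    by (simp add: pathfinish_def pathstart_def p_def c_def)
  moreover have "(a \<circ> circlepath 0 1) t = (exp \<circ> p) t" for t
  proof -
    have "exp (p t) * exp (g1 (1 / c t)) = c t ^ n * exp (g2 (c t))"
      by (simp add: p_def c_def exp_diff exp_add exp_of_nat_mult)
    also have "\<dots> = a (c t) * exp (g1 (1 / c t))"
      using a[of "c t"] g1(2)[of "1 / c t"] g2(2)[of "c t"] norm_c[of t] norm_inv_c[of t] by simp
    finally show ?thesis by (simp add: c)
  qed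
  then have "a \<circ> circlepath 0 1 = exp \<circ> p" by blast
  ultimately show ?thesis by simp
qed

section \<open>Topology of the orbit\<close>

context sl2_weight_basis
begin

abbreviation "orbit \<equiv> highest_weight_orbit \<rho> v"
abbreviation "orbit_topology \<equiv> subtopology proj_topology orbit"

lemma continuous_map_curve:
  assumes "continuous_on D p" "continuous_on D q" "\<And>z. z \<in> D \<Longrightarrow> p z \<noteq> 0 \<or> q z \<noteq> 0"
  shows "continuous_map (top_of_set D) (taut_total orbit) (\<lambda>z. curve (p z) (q z))"
proof -
  have "continuous_on D (\<lambda>z. curve (p z) (q z))"
    unfolding curve_def
    by (intro continuous_intros bounded_linear.continuous_on[OF bounded_linear_vscale] assms) simp
  moreover have "curve (p z) (q z) \<noteq> 0" "proj_point (curve (p z) (q z)) \<in> orbit" if "z \<in> D" for z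
    using assms(3)[OF that] by (simp_all add: curve_eq_zero_iff curve_in_orbit)
  ultimately show ?thesis by (auto simp: taut_total_def)
qed

text \<open>The injection \<open>orbit_to_sphere\<close> into Euclidean space is continuous, since
  its pullback to the cone is smooth and the cone projects by a quotient map.\<close>

lemma Hausdorff_orbit: "Hausdorff_space orbit_topology"
proof (rule Hausdorff_space_injective_preimage)
  have "continuous_map (taut_total orbit) euclidean (orbit_to_sphere \<circ> proj_point)"
    using smooth_map_on_continuous[OF smooth_orbit_to_sphere] by (simp add: taut_total_def o_def)
  then show "continuous_map orbit_topology euclidean orbit_to_sphere"
    by (rule continuous_compose_quotient_map[OF quotient_map_taut_total[OF orbit_subset_proj_space]])
  show "inj_on orbit_to_sphere (topspace orbit_topology)"
    by (metis (no_types, lifting) Int_iff inj_onI sphere_to_orbit_to_sphere(2) topspace_subtopology)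
qed simp

lemma topspace_orbit: "topspace orbit_topology = orbit"
  using orbit_subset_proj_space by (simp add: topspace_proj_topology Int_absorb1)

text \<open>A continuous injection of a compact space into a Hausdorff space is an embedding;
  injectivity reduces to cross products of pairs.\<close>

lemma embedding_map_curve:
  assumes "continuous_on (cball 0 1) p" "continuous_on (cball 0 1) q"
    and "\<And>z. z \<in> cball 0 1 \<Longrightarrow> p z \<noteq> 0 \<or> q z \<noteq> 0"
    and inj: "\<And>z w. z \<in> cball 0 1 \<Longrightarrow> w \<in> cball 0 1 \<Longrightarrow> p z * q w = p w * q z \<Longrightarrow> z = w"
  shows "embedding_map (top_of_set (cball (0::complex) 1)) orbit_topology (\<lambda>z. proj_point (curve (p z) (q z)))"
proof (rule continuous_imp_embedding_map)
  show "continuous_map (top_of_set (cball 0 1)) orbit_topology (\<lambda>z. proj_point (curve (p z) (q z)))"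
    using continuous_map_compose[OF continuous_map_curve[OF assms(1-3)]
        quotient_imp_continuous_map[OF quotient_map_taut_total[OF orbit_subset_proj_space]]]
    by (simp add: o_def)
  show "compact_space (top_of_set (cball (0::complex) 1))"
    by (simp add: compact_space_subtopology)
  show "inj_on (\<lambda>z. proj_point (curve (p z) (q z))) (topspace (top_of_set (cball 0 1)))"
    using inj assms(3) proj_point_curve_eqD by (intro inj_onI) simp
qed (rule Hausdorff_orbit)

lemma hemispheres_curve:
  "hemispheres orbit_topology (\<lambda>z. proj_point (curve 1 z)) (\<lambda>w. proj_point (curve w 1))"
  unfolding hemispheres_def
proof (intro conjI ballI)
  show "embedding_map (top_of_set (cball 0 1)) orbit_topology (\<lambda>z. proj_point (curve 1 z))"
    by (rule embedding_map_curve) (auto intro: continuous_intros)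
  show "embedding_map (top_of_set (cball 0 1)) orbit_topology (\<lambda>w. proj_point (curve w 1))"
    by (rule embedding_map_curve) (auto intro: continuous_intros)
  show eq: "proj_point (curve 1 (1 / w)) = proj_point (curve w 1)" if "w \<in> sphere 0 1" for w
    using that by (intro proj_point_curve_eqI) auto
  show "(\<lambda>z. proj_point (curve 1 z)) ` cball 0 1 \<union> (\<lambda>w. proj_point (curve w 1)) ` cball 0 1
      = topspace orbit_topology" (is "?U1 \<union> ?U2 = _")
    unfolding topspace_orbit
  proof (intro subset_antisym subsetI)
    fix L assume "L \<in> orbit"
    then obtain a b where ab: "a \<noteq> 0 \<or> b \<noteq> 0" and L: "L = proj_point (curve a b)"
      using in_orbitE by blast
    show "L \<in> ?U1 \<union> ?U2"
    \<comment> \<open>Dividing by the coordinate of larger modulus puts the point into one of the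
      discs.\<close>
    proof (cases "norm b \<le> norm a")
      case True
      then have "a \<noteq> 0" using ab by auto
      then have "L = proj_point (curve 1 (b / a))"
        unfolding L by (intro proj_point_curve_eqI) auto
      moreover have "b / a \<in> cball 0 1" using True \<open>a \<noteq> 0\<close> by (simp add: norm_divide)
      ultimately show ?thesis by blast
    next
      case False
      then have "b \<noteq> 0" by auto
      then have "L = proj_point (curve (a / b) 1)"
        unfolding L by (intro proj_point_curve_eqI) auto
      moreover have "a / b \<in> cball 0 1" using False \<open>b \<noteq> 0\<close> by (simp add: norm_divide)
      ultimately show ?thesis by blast
    qed
  qed (auto intro!: curve_in_orbit)
  show "?U1 \<inter> ?U2 = (\<lambda>w. proj_point (curve w 1)) ` sphere 0 1"
  proof (intro subset_antisym subsetI)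
    fix L assume "L \<in> ?U1 \<inter> ?U2"
    then obtain z w where zw: "norm z \<le> 1" "norm w \<le> 1" "L = proj_point (curve 1 z)" "L = proj_point (curve w 1)"
      by auto
    \<comment> \<open>If w z = 1 and both moduli are at most 1, both equal 1.\<close>
    then have "1 * 1 = w * z" by (intro proj_point_curve_eqD) auto
    then have "norm w * norm z = 1" by (metis mult_1 norm_mult norm_one)
    then have "norm w = 1"
      using zw(1,2) mult_left_le[of "norm z" "norm w"] by simp
    then show "L \<in> (\<lambda>w. proj_point (curve w 1)) ` sphere 0 1" using zw(4) by auto
  next
    fix L assume "L \<in> (\<lambda>w. proj_point (curve w 1)) ` sphere 0 1"
    then obtain w where w: "norm w = 1" "L = proj_point (curve w 1)" by auto
    moreover have "L = proj_point (curve 1 (1 / w))" using eq[of w] w by simp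
    ultimately show "L \<in> ?U1 \<inter> ?U2"
      by (auto intro!: image_eqI[of _ _ "1 / w"] simp: norm_divide)
  qed
qed

section \<open>Sections of the tautological bundle\<close>

abbreviation "clutches \<equiv> clutching_function (taut_total orbit) orbit_topology proj_point (*s)
  (\<lambda>z. proj_point (curve 1 z)) (\<lambda>w. proj_point (curve w 1))"

text \<open>The sections are the lifts F(1, z) and F(w, 1), with the disc coordinates recovered by
  inverting the two embeddings; homogeneity compares them on the equator.\<close>

lemma clutching_power: "clutches (\<lambda>w. w ^ n)"
proof -
  have emb: "embedding_map (top_of_set (cball 0 1)) orbit_topology (\<lambda>z. proj_point (curve 1 z))"
      "embedding_map (top_of_set (cball 0 1)) orbit_topology (\<lambda>w. proj_point (curve w 1))"
    using hemispheres_curve unfolding hemispheres_def by blast+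
  obtain g1 where g1: "continuous_map (subtopology orbit_topology ((\<lambda>z. proj_point (curve 1 z)) ` cball 0 1)) (top_of_set (cball 0 1)) g1"
      "\<And>z. z \<in> cball 0 1 \<Longrightarrow> g1 (proj_point (curve 1 z)) = z"
    using embedding_map_inverseE[OF emb(1)] by (metis topspace_euclidean_subtopology)
  obtain g2 where g2: "continuous_map (subtopology orbit_topology ((\<lambda>w. proj_point (curve w 1)) ` cball 0 1)) (top_of_set (cball 0 1)) g2"
      "\<And>w. w \<in> cball 0 1 \<Longrightarrow> g2 (proj_point (curve w 1)) = w"
    using embedding_map_inverseE[OF emb(2)] by (metis topspace_euclidean_subtopology)
  show ?thesis
    unfolding clutching_function_def section_over_def
  proof (intro conjI exI ballI)
    show "continuous_on (sphere 0 1) (\<lambda>w :: complex. w ^ n)" by (intro continuous_intros)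
    show "(\<lambda>w. w ^ n) ` sphere 0 1 \<subseteq> - {0 :: complex}" by auto
    show "continuous_map (subtopology orbit_topology ((\<lambda>z. proj_point (curve 1 z)) ` cball 0 1))
        (taut_total orbit) ((\<lambda>z. curve 1 z) \<circ> g1)"
      by (intro continuous_map_compose[OF g1(1)] continuous_map_curve) (auto intro: continuous_intros)
    show "continuous_map (subtopology orbit_topology ((\<lambda>w. proj_point (curve w 1)) ` cball 0 1))
        (taut_total orbit) ((\<lambda>w. curve w 1) \<circ> g2)"
      by (intro continuous_map_compose[OF g2(1)] continuous_map_curve) (auto intro: continuous_intros)
    show "proj_point (((\<lambda>z. curve 1 z) \<circ> g1) L) = L" if "L \<in> (\<lambda>z. proj_point (curve 1 z)) ` cball 0 1" for L
      using that g1(2) by auto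
    show "proj_point (((\<lambda>w. curve w 1) \<circ> g2) L) = L" if "L \<in> (\<lambda>w. proj_point (curve w 1)) ` cball 0 1" for L
      using that g2(2) by auto
    fix w :: complex assume w: "w \<in> sphere 0 1"
    then have "proj_point (curve w 1) = proj_point (curve 1 (1 / w))"
      by (intro proj_point_curve_eqI) auto
    moreover have "curve w 1 = w ^ n *s curve 1 (1 / w)"
      using curve_scale[of w 1 "1 / w"] w by (cases "w = 0") auto
    ultimately show "((\<lambda>w. curve w 1) \<circ> g2) (proj_point (curve w 1)) = w ^ n *s ((\<lambda>z. curve 1 z) \<circ> g1) (proj_point (curve w 1))"
      using w g1(2)[of "1 / w"] g2(2)[of w] by (simp add: norm_divide)
  qed
qed

text \<open>A section over a hemisphere differs from the standard one by a nowhere zero function on the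
  disc, which a coordinate functional reads off.\<close>

lemma section_factor:
  assumes sec: "section_over (taut_total orbit) orbit_topology proj_point
      ((\<lambda>z. proj_point (curve (p z) (q z))) ` cball (0::complex) 1) \<sigma>"
    and cont: "continuous_on (cball 0 1) p" "continuous_on (cball 0 1) q"
    and nz: "\<And>z. z \<in> cball 0 1 \<Longrightarrow> p z \<noteq> 0 \<or> q z \<noteq> 0"
    and coord: "\<And>z. r * coord j (curve (p z) (q z)) = 1"
  shows "\<exists>u. continuous_on (cball 0 1) u \<and>
    (\<forall>z\<in>cball 0 1. u z \<noteq> 0 \<and> \<sigma> (proj_point (curve (p z) (q z))) = u z *s curve (p z) (q z))"
proof -
  let ?h = "\<lambda>z. proj_point (curve (p z) (q z))"
  define u where "u z = r * coord j (\<sigma> (?h z))" for z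
  have "continuous_map (top_of_set (cball 0 1)) (subtopology orbit_topology (?h ` cball 0 1)) ?h"
    using continuous_map_compose[OF continuous_map_curve[OF cont nz]
        quotient_imp_continuous_map[OF quotient_map_taut_total[OF orbit_subset_proj_space]]]
    by (simp add: o_def continuous_map_in_subtopology)
  then have "continuous_map (top_of_set (cball 0 1)) (taut_total orbit) (\<sigma> \<circ> ?h)"
    by (rule continuous_map_compose) (use sec in \<open>simp add: section_over_def\<close>)
  then have \<sigma>: "continuous_on (cball 0 1) (\<lambda>z. \<sigma> (?h z))" "\<And>z. z \<in> cball 0 1 \<Longrightarrow> \<sigma> (?h z) \<noteq> 0"
    by (auto simp: taut_total_def o_def)
  have "continuous_on (cball 0 1) u"
    unfolding u_def by (intro continuous_intros bounded_linear.continuous_on[OF bounded_linear_coord] \<sigma>)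
  moreover have "u z \<noteq> 0 \<and> \<sigma> (?h z) = u z *s curve (p z) (q z)" if z: "z \<in> cball 0 1" for z
  proof -
    have "proj_point (curve (p z) (q z)) = proj_point (\<sigma> (?h z))"
      using sec z unfolding section_over_def by auto
    then obtain c where c: "c \<noteq> 0" "\<sigma> (?h z) = c *s curve (p z) (q z)"
      using \<sigma>(2)[OF z] proj_point_eqD by blast
    moreover have "u z = c"
      using coord[of z] by (simp add: u_def c(2) coord_scale mult.left_commute)
    ultimately show ?thesis by simp
  qed
  ultimately show ?thesis by blast
qed

lemma winding_number_clutches:
  assumes "clutches a"
  shows "winding_number (a \<circ> circlepath 0 1) 0 = of_int (int n)"
proof -
  obtain \<sigma>1 \<sigma>2 where \<sigma>1: "section_over (taut_total orbit) orbit_topology proj_point ((\<lambda>z. proj_point (curve 1 z)) ` cball 0 1) \<sigma>1"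
    and \<sigma>2: "section_over (taut_total orbit) orbit_topology proj_point ((\<lambda>w. proj_point (curve w 1)) ` cball 0 1) \<sigma>2"
    and a: "\<And>w. w \<in> sphere 0 1 \<Longrightarrow> \<sigma>2 (proj_point (curve w 1)) = a w *s \<sigma>1 (proj_point (curve w 1))"
    using assms unfolding clutching_function_def by blast
  \<comment> \<open>Normalized functionals: coordinate 0 is 1 on \<open>curve 1 z\<close>, and
    below, \<open>fact n\<close> times coordinate \<open>n\<close> is 1 on
    \<open>curve w 1\<close>.\<close>
  obtain u1 where u1: "continuous_on (cball 0 1) u1"
      "\<And>z. z \<in> cball 0 1 \<Longrightarrow> u1 z \<noteq> 0 \<and> \<sigma>1 (proj_point (curve 1 z)) = u1 z *s curve 1 z"
    using section_factor[OF \<sigma>1, of 1 0] by (auto simp: coord_curve continuous_on_id)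
  obtain u2 where u2: "continuous_on (cball 0 1) u2"
      "\<And>w. w \<in> cball 0 1 \<Longrightarrow> u2 w \<noteq> 0 \<and> \<sigma>2 (proj_point (curve w 1)) = u2 w *s curve w 1"
    using section_factor[OF \<sigma>2, of "fact n" n] by (auto simp: coord_curve continuous_on_id)
  have "winding_number (a \<circ> circlepath 0 1) 0 = of_nat n"
  proof (rule winding_number_clutching)
    fix w :: complex assume w: "w \<in> sphere 0 1"
    then have w0: "w \<noteq> 0" and wc: "w \<in> cball 0 1" "1 / w \<in> cball 0 1" by (auto simp: norm_divide)
    have "proj_point (curve w 1) = proj_point (curve 1 (1 / w))"
      using w0 by (intro proj_point_curve_eqI) auto
    then have "u2 w *s curve w 1 = a w *s (u1 (1 / w) *s curve 1 (1 / w))"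
      using a[OF w] u1(2)[OF wc(2)] u2(2)[OF wc(1)] by simp
    \<comment> \<open>Coordinate 0 is \<open>w ^ n\<close> on \<open>curve w 1\<close> and 1 on
      \<open>curve 1 (1 / w)\<close>.\<close>
    from arg_cong[OF this, of "coord 0"] show "a w * u1 (1 / w) = w ^ n * u2 w"
      by (simp add: coord_scale coord_curve mult.commute)
  qed (use u1 u2 in auto)
  then show ?thesis by simp
qed

theorem represented_by_class_taut:
  "represented_by_class (taut_total orbit) orbit_topology proj_point (*s)
     (\<lambda>z. proj_point (curve 1 z)) (\<lambda>w. proj_point (curve w 1)) (int n)"
  unfolding represented_by_class_def
  using hemispheres_curve clutching_power winding_number_clutches by blast

theorem taut_nontrivial: "\<not> trivial_line_bundle (taut_total orbit) orbit_topology proj_point (*s)"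
proof
  assume "trivial_line_bundle (taut_total orbit) orbit_topology proj_point (*s)"
  then have "clutches (\<lambda>_. 1)"
    by (rule trivial_line_bundle_clutching[OF _ hemispheres_curve]) simp
  then have "winding_number ((\<lambda>_. 1) \<circ> circlepath 0 1) 0 = of_int (int n)"
    by (rule winding_number_clutches)
  \<comment> \<open>A constant loop has winding number 0, which contradicts
    \<open>n \<ge> 1\<close>.\<close>
  moreover have "(\<lambda>_. 1) \<circ> circlepath 0 1 = linepath 1 (1 :: complex)"
    by (simp add: fun_eq_iff linepath_def flip: of_real_add scaleR_add_left)
  ultimately show False
    using n_pos winding_number_zero_const[of 1 0] by (simp add: linepath_refl)
qed

end

theorem proposition5p2:
  fixes n :: nat
    and \<rho> :: "complex^2^2 \<Rightarrow> complex^'n^'n"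
    and v :: "nat \<Rightarrow> complex^'n"
  assumes "n \<ge> 1"
    and "CARD('n) = n + 1"
    and "irreducible_sl2_representation \<rho>"
    and "weight_basis \<rho> n v"
  shows "diffeomorphic_proj (sphere (0 :: real^3) 1) (highest_weight_orbit \<rho> v) \<and>
         \<not> trivial_line_bundle
             (taut_total (highest_weight_orbit \<rho> v))
             (subtopology proj_topology (highest_weight_orbit \<rho> v))
             proj_point (*s) \<and>
         represented_by_class
             (taut_total (highest_weight_orbit \<rho> v))
             (subtopology proj_topology (highest_weight_orbit \<rho> v))
             proj_point (*s)
             (\<lambda>z. proj_point (mat_exp (mat_scale z (\<rho> sl_Y)) *v v 0))
             (\<lambda>w. proj_point (mat_exp (mat_scale w (\<rho> sl_X)) *v v n))
             (int n)"
proof -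
  interpret sl2_weight_basis n \<rho> v
    using assms by unfold_locales (simp_all add: irreducible_sl2_representation_def)
  \<comment> \<open>The hemispheres of the statement are spanned by F(1, z) and n! F(w, 1); the
    factor n! disappears in projective space.\<close>
  show ?thesis
    using diffeomorphic_sphere_orbit taut_nontrivial represented_by_class_taut
    by (simp add: mat_exp_X mat_exp_Y proj_point_scale)
qed

end
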